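(* Let $k$ be an infinite field, let $B$ be a Lie algebra and $(L_i)_{i\in I}$ a family of Lie algebras over $k$, and let $f:L=\prod_{i\in I} L_i\to B$ be a surjective homomorphism of Lie algebras. Suppose also that at least one of the following three conditions holds: (i) $\dim_k(B)<\mathrm{card}(k)$ and $\mathrm{card}(I)\leq\mathrm{card}(k)$; or (ii) $\dim_k(B)<2^{\aleph_0}$ and $\mathrm{card}(I)=\aleph_0$; or (iii) $\dim_k(B)$ is finite, and $\mathrm{card}(I)$ is less than every measurable cardinal $>\mathrm{card}(k)$ (if any exist). Then if all $L_i$ are solvable, respectively, nilpotent, $B$ is as well (solvable, respectively, nilpotent), and $B$ is in fact the sum of its center $Z(B)$ and the (mutually centralizing) images under $f$ of finitely many of the $L_i$.
   Context: Each $L_i$ is identified with the subalgebra of $L$ consisting of the elements whose components are zero outside the index $i$; products carry componentwise operations. $Z(B)=\{x\in B\mid [x,B]=\{0\}\}$ is the center of $B$. Lie algebras are not assumed finite-dimensional. A measurable cardinal is a cardinal $\mu$ admitting a nonprincipal $\mu$-complete ultrafilter (closed under intersections of fewer than $\mu$ members); by convention $\aleph_0$ is counted as measurable (irrelevant here for cardinals $>\mathrm{card}(k)$, as $k$ is infinite). *)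

theory Defs
  imports "Jordan_Normal_Form.Missing_VectorSpace" "HOL-Library.FuncSet"
begin

unbundle cardinal_syntax

section \<open>Lie algebras over a field\<close>

text \<open>
  A Lie algebra is carried by the \<open>module\<close> record of HOL-Algebra; the otherwise unused
  ring multiplication \<open>\<otimes>\<close> of the record is the Lie bracket, and the field \<open>one\<close> plays no role.
  No finiteness of the dimension is assumed.
\<close>

locale lie_algebra = vectorspace K L for K and L +
  assumes bracket_closed:
      "\<lbrakk>x \<in> carrier L; y \<in> carrier L\<rbrakk> \<Longrightarrow> x \<otimes>\<^bsub>L\<^esub> y \<in> carrier L"
    and bracket_add_left:
      "\<lbrakk>x \<in> carrier L; y \<in> carrier L; z \<in> carrier L\<rbrakk> \<Longrightarrow>
       (x \<oplus>\<^bsub>L\<^esub> y) \<otimes>\<^bsub>L\<^esub> z = (x \<otimes>\<^bsub>L\<^esub> z) \<oplus>\<^bsub>L\<^esub> (y \<otimes>\<^bsub>L\<^esub> z)"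
    and bracket_add_right:
      "\<lbrakk>x \<in> carrier L; y \<in> carrier L; z \<in> carrier L\<rbrakk> \<Longrightarrow>
       x \<otimes>\<^bsub>L\<^esub> (y \<oplus>\<^bsub>L\<^esub> z) = (x \<otimes>\<^bsub>L\<^esub> y) \<oplus>\<^bsub>L\<^esub> (x \<otimes>\<^bsub>L\<^esub> z)"
    and bracket_smult_left:
      "\<lbrakk>c \<in> carrier K; x \<in> carrier L; y \<in> carrier L\<rbrakk> \<Longrightarrow>
       (c \<odot>\<^bsub>L\<^esub> x) \<otimes>\<^bsub>L\<^esub> y = c \<odot>\<^bsub>L\<^esub> (x \<otimes>\<^bsub>L\<^esub> y)"
    and bracket_smult_right:
      "\<lbrakk>c \<in> carrier K; x \<in> carrier L; y \<in> carrier L\<rbrakk> \<Longrightarrow>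
       x \<otimes>\<^bsub>L\<^esub> (c \<odot>\<^bsub>L\<^esub> y) = c \<odot>\<^bsub>L\<^esub> (x \<otimes>\<^bsub>L\<^esub> y)"
    and bracket_self:
      "x \<in> carrier L \<Longrightarrow> x \<otimes>\<^bsub>L\<^esub> x = \<zero>\<^bsub>L\<^esub>"
    and jacobi:
      "\<lbrakk>x \<in> carrier L; y \<in> carrier L; z \<in> carrier L\<rbrakk> \<Longrightarrow>
       (x \<otimes>\<^bsub>L\<^esub> (y \<otimes>\<^bsub>L\<^esub> z)) \<oplus>\<^bsub>L\<^esub> (y \<otimes>\<^bsub>L\<^esub> (z \<otimes>\<^bsub>L\<^esub> x)) \<oplus>\<^bsub>L\<^esub> (z \<otimes>\<^bsub>L\<^esub> (x \<otimes>\<^bsub>L\<^esub> y)) = \<zero>\<^bsub>L\<^esub>"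

definition lie_hom ::
  "('k, 'm) ring_scheme \<Rightarrow> ('k, 'a) module \<Rightarrow> ('k, 'b) module \<Rightarrow> ('a \<Rightarrow> 'b) set"
  where "lie_hom K L B =
    {f \<in> module_hom K L B.
       \<forall>x\<in>carrier L. \<forall>y\<in>carrier L. f (x \<otimes>\<^bsub>L\<^esub> y) = f x \<otimes>\<^bsub>B\<^esub> f y}"

definition lie_center :: "('k, 'a) module \<Rightarrow> 'a set"
  where "lie_center L = {x \<in> carrier L. \<forall>y\<in>carrier L. x \<otimes>\<^bsub>L\<^esub> y = \<zero>\<^bsub>L\<^esub>}"

text \<open>The subspace \<open>[S, T]\<close> spanned by all brackets of elements of \<open>S\<close> with elements of \<open>T\<close>.\<close>

definition bracket_span ::
  "('k, 'm) ring_scheme \<Rightarrow> ('k, 'a) module \<Rightarrow> 'a set \<Rightarrow> 'a set \<Rightarrow> 'a set"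
  where "bracket_span K L S T =
    LinearCombinations.module.span K L {x \<otimes>\<^bsub>L\<^esub> y | x y. x \<in> S \<and> y \<in> T}"

primrec derived_series ::
  "('k, 'm) ring_scheme \<Rightarrow> ('k, 'a) module \<Rightarrow> nat \<Rightarrow> 'a set"
  where
    "derived_series K L 0 = carrier L"
  | "derived_series K L (Suc n) = bracket_span K L (derived_series K L n) (derived_series K L n)"

primrec lower_central_series ::
  "('k, 'm) ring_scheme \<Rightarrow> ('k, 'a) module \<Rightarrow> nat \<Rightarrow> 'a set"
  where
    "lower_central_series K L 0 = carrier L"
  | "lower_central_series K L (Suc n) = bracket_span K L (carrier L) (lower_central_series K L n)"

definition lie_solvable :: "('k, 'm) ring_scheme \<Rightarrow> ('k, 'a) module \<Rightarrow> bool"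
  where "lie_solvable K L \<longleftrightarrow> (\<exists>n. derived_series K L n = {\<zero>\<^bsub>L\<^esub>})"

definition lie_nilpotent :: "('k, 'm) ring_scheme \<Rightarrow> ('k, 'a) module \<Rightarrow> bool"
  where "lie_nilpotent K L \<longleftrightarrow> (\<exists>n. lower_central_series K L n = {\<zero>\<^bsub>L\<^esub>})"


section \<open>Direct products\<close>

text \<open>
  A family of Lie algebras is a function from indices to records, each with its own carrier and
  its own operations on that carrier. That the carriers are sets over one type \<open>'a\<close> is no
  restriction, as every set-indexed family of sets embeds into its disjoint union.
\<close>

definition lie_prod :: "'i set \<Rightarrow> ('i \<Rightarrow> ('k, 'a) module) \<Rightarrow> ('k, 'i \<Rightarrow> 'a) module"
  where "lie_prod I L =
    \<lparr>carrier = (\<Pi>\<^sub>E i\<in>I. carrier (L i)),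
     mult = (\<lambda>x y. \<lambda>i\<in>I. x i \<otimes>\<^bsub>L i\<^esub> y i),
     one = undefined,
     zero = (\<lambda>i\<in>I. \<zero>\<^bsub>L i\<^esub>),
     add = (\<lambda>x y. \<lambda>i\<in>I. x i \<oplus>\<^bsub>L i\<^esub> y i),
     smult = (\<lambda>c x. \<lambda>i\<in>I. c \<odot>\<^bsub>L i\<^esub> x i)\<rparr>"

text \<open>The factor \<open>L i\<close>, identified with a subalgebra of the product.\<close>

definition lie_factor :: "'i set \<Rightarrow> ('i \<Rightarrow> ('k, 'a) module) \<Rightarrow> 'i \<Rightarrow> ('i \<Rightarrow> 'a) set"
  where "lie_factor I L i =
    {x \<in> carrier (lie_prod I L). \<forall>j\<in>I. j \<noteq> i \<longrightarrow> x j = \<zero>\<^bsub>L j\<^esub>}"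

text \<open>
  \<open>B\<close> is the sum of its center and the pairwise centralizing images under \<open>f\<close> of finitely many
  of the factors. A sum of subspaces is written out as the set of sums of their elements.
\<close>

definition center_plus_finite_images ::
  "'i set \<Rightarrow> ('i \<Rightarrow> ('k, 'a) module) \<Rightarrow> ('k, 'b) module \<Rightarrow> (('i \<Rightarrow> 'a) \<Rightarrow> 'b) \<Rightarrow> bool"
  where "center_plus_finite_images I L B f \<longleftrightarrow>
    (\<exists>J. finite J \<and> J \<subseteq> I \<and>
      carrier B =
        {z \<oplus>\<^bsub>B\<^esub> (\<Oplus>\<^bsub>B\<^esub>j\<in>J. y j) | z y.
           z \<in> lie_center B \<and> y \<in> (\<Pi> j\<in>J. f ` lie_factor I L j)} \<and>
      (\<forall>i\<in>J. \<forall>j\<in>J. i \<noteq> j \<longrightarrow>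
        (\<forall>u \<in> f ` lie_factor I L i. \<forall>v \<in> f ` lie_factor I L j. u \<otimes>\<^bsub>B\<^esub> v = \<zero>\<^bsub>B\<^esub>)))"


section \<open>Measurable cardinals\<close>

definition ultrafilter_on :: "'c set \<Rightarrow> 'c set set \<Rightarrow> bool"
  where "ultrafilter_on X U \<longleftrightarrow>
    U \<subseteq> Pow X \<and> X \<in> U \<and> {} \<notin> U \<and>
    (\<forall>S\<in>U. \<forall>T. S \<subseteq> T \<and> T \<subseteq> X \<longrightarrow> T \<in> U) \<and>
    (\<forall>S\<in>U. \<forall>T\<in>U. S \<inter> T \<in> U) \<and>
    (\<forall>S. S \<subseteq> X \<longrightarrow> S \<in> U \<or> X - S \<in> U)"

definition nonprincipal_on :: "'c set \<Rightarrow> 'c set set \<Rightarrow> bool"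
  where "nonprincipal_on X U \<longleftrightarrow> (\<forall>x\<in>X. U \<noteq> {S. S \<subseteq> X \<and> x \<in> S})"

text \<open>
  Cardinals are the library's cardinal well-orders. A nonprincipal ultrafilter only lives on
  an infinite set, so finite cardinals are excluded; \<open>\<aleph>\<^sub>0\<close> counts as measurable.
\<close>

definition measurable_cardinal :: "'c rel \<Rightarrow> bool"
  where "measurable_cardinal r \<longleftrightarrow> Card_order r \<and>
    (\<exists>U. ultrafilter_on (Field r) U \<and> nonprincipal_on (Field r) U \<and>
         (\<forall>F. F \<subseteq> U \<and> F \<noteq> {} \<and> |F| <o r \<longrightarrow> \<Inter>F \<in> U))"

text \<open>
  For \<open>I :: 'i set\<close> it suffices to let the cardinals range over the relations on \<open>'i\<close>: up to
  isomorphism these are all cardinals that are at most the cardinality of \<open>'i\<close>, hence include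
  all those at most the cardinality of \<open>I\<close>, and any other cardinal is larger than that of \<open>I\<close> anyway.
\<close>

definition below_measurables_above :: "'i set \<Rightarrow> 'k set \<Rightarrow> bool"
  where "below_measurables_above I C \<longleftrightarrow>
    (\<forall>r :: 'i rel. measurable_cardinal r \<and> |C| <o r \<longrightarrow> |I| <o r)"

end

theory Submission
  imports Defs "HOL-Algebra.Free_Abelian_Groups"
begin

text \<open>
  The product \<open>L\<close> is a module over the ring \<open>K\<^sup>I\<close>, and its bracket is bilinear over that ring. Since
  \<open>f\<close> is surjective, \<open>[f (g x), f y] = [f x, f (g y)]\<close> shows that for each \<open>x\<close> the set of
  \<open>g \<in> K\<^sup>I\<close> with \<open>f (g x)\<close> central is closed under multiplication by \<open>K\<^sup>I\<close>; hence the sets \<open>S \<subseteq> I\<close> for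
  which the restriction of \<open>x\<close> to \<open>S\<close> has central image form an ideal \<open>N\<^sub>x\<close> of sets. The point is
  that \<open>N\<^sub>x\<close> contains a cofinite set.

  If \<open>dim B < card K\<close>, then for \<open>g : I \<rightarrow> K\<close> the images of \<open>(g - l)\<^bsup>-1\<^esup> x\<close>, \<open>l \<in> K\<close>, are linearly
  dependent. A nontrivial combination of the functions \<open>(g - l)\<^bsup>-1\<^esup>\<close> vanishes on finitely many fibres
  of \<open>g\<close> only, so the union of all but finitely many fibres of \<open>g\<close> is in \<open>N\<^sub>x\<close>. In case (i) apply this
  to an injective \<open>g\<close>. In case (iii), a failure would give a nonprincipal ultrafilter on \<open>I\<close> that
  contains a fibre of every \<open>g : I \<rightarrow> K\<close>; the least number of its members whose intersection is not a
  member is a measurable cardinal above \<open>card K\<close>. In case (ii) one may assume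
  \<open>card K < 2\<^bsup>\<aleph>\<^sub>0\<^esup>\<close>; then \<open>card B < 2\<^bsup>\<aleph>\<^sub>0\<^esup>\<close>, so two of \<open>2\<^bsup>\<aleph>\<^sub>0\<^esup>\<close> pairwise eventually different
  functions \<open>g\<close> have the same \<open>f (g x)\<close>.

  If infinitely many factors had a noncentral image, assembling one witness from each into a single
  \<open>x\<close> would contradict this. So all but finitely many factors can be dropped at the cost of the center.
\<close>

section \<open>Ideals of sets and measurable cardinals\<close>

text \<open>The set carrying \<open>U\<close> may be too large, so \<open>U\<close> is pushed
  forward to a smallest family \<open>F\<close> of members of \<open>U\<close> whose intersection is
  not in \<open>U\<close>. Minimality of \<open>F\<close> makes the image complete, it is
  nonprincipal because no fibre of \<open>p\<close> is in \<open>U\<close>, and \<open>fib\<close>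
  makes \<open>F\<close> larger than \<open>C\<close>.\<close>

lemma measurable_cardinal_of_ultrafilter:
  fixes I :: "'i set"
  assumes U: "ultrafilter_on I U" and np: "nonprincipal_on I U" and C: "infinite C"
    and fib: "\<And>g. g \<in> I \<rightarrow> C \<Longrightarrow> \<exists>c\<in>C. {i\<in>I. g i = c} \<in> U"
  shows "\<exists>r :: 'i rel. measurable_cardinal r \<and> |C| <o r \<and> r \<le>o |I|"
proof -
  have UI: "\<And>S. S \<in> U \<Longrightarrow> S \<subseteq> I" and I_U: "I \<in> U" and empty_U: "{} \<notin> U"
    and up: "\<And>S T. \<lbrakk>S \<in> U; S \<subseteq> T; T \<subseteq> I\<rbrakk> \<Longrightarrow> T \<in> U"
    and int: "\<And>S T. \<lbrakk>S \<in> U; T \<in> U\<rbrakk> \<Longrightarrow> S \<inter> T \<in> U"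
    and max: "\<And>S. S \<subseteq> I \<Longrightarrow> S \<in> U \<or> I - S \<in> U"
    using U unfolding ultrafilter_on_def by blast+
  have compl: "I - S \<in> U \<longleftrightarrow> S \<notin> U" if "S \<subseteq> I" for S
    using int[of S "I - S"] max[OF that] empty_U by auto
  have un: "S \<in> U \<or> T \<in> U" if "S \<union> T \<in> U" for S T
  proof (rule ccontr)
    assume "\<not> ?thesis"
    moreover have "S \<subseteq> I" "T \<subseteq> I" using UI[OF that] by auto
    ultimately have "I - S \<in> U" "I - T \<in> U" by (simp_all add: compl)
    then have "(I - S) \<inter> (I - T) \<inter> (S \<union> T) \<in> U" using that by (intro int)
    moreover have "(I - S) \<inter> (I - T) \<inter> (S \<union> T) = {}" by blast
    ultimately show False using empty_U by simp
  qed
  have sing: "{x} \<notin> U" for x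
  proof
    assume x: "{x} \<in> U"
    then have "x \<in> I" using UI by blast
    moreover have "S \<in> U \<longleftrightarrow> x \<in> S" if "S \<subseteq> I" for S
      using up[OF x, of S] int[OF x, of S] that empty_U by (cases "x \<in> S") auto
    then have "U = {S. S \<subseteq> I \<and> x \<in> S}" using UI by blast
    ultimately show False using np by (auto simp: nonprincipal_on_def)
  qed
  define bad where "bad = (\<lambda>F. F \<subseteq> U \<and> F \<noteq> {} \<and> \<Inter>F \<notin> U)"
  \<comment> \<open>No singleton is in \<open>U\<close>, so the complements of points are members,
    and their intersection is empty. Bad families thus exist, and a smallest one has at most
    \<open>|I|\<close> members.\<close>
  have bad0: "bad ((\<lambda>x. I - {x}) ` I)"
    using sing compl I_U empty_U by (auto simp: bad_def)
  have "\<exists>r\<in>card_of ` Collect bad. \<forall>r'\<in>card_of ` Collect bad. r \<le>o r'"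
    by (rule exists_minim_Card_order) (use bad0 in auto)
  then obtain F where F: "bad F" and Fmin: "\<And>G. bad G \<Longrightarrow> |F| \<le>o |G|" by auto
  have FI: "|F| \<le>o |I|"
    using ordLeq_transitive[OF Fmin[OF bad0] card_of_image] .
  \<comment> \<open>The conclusion asks for a relation on \<open>'i\<close>, whereas
    \<open>F\<close> is a set of sets; \<open>e\<close> replaces it by a copy inside
    \<open>I\<close>.\<close>
  then obtain e where e: "inj_on e F" "e ` F \<subseteq> I"
    using card_of_ordLeq[of F I] by blast
  have eF: "|F| =o |e ` F|" using e(1) card_of_ordIso[of F "e ` F"] inj_on_imp_bij_betw by blast
  have FU: "\<And>A. A \<in> F \<Longrightarrow> A \<in> U" and Fne: "F \<noteq> {}" and FN: "\<Inter>F \<notin> U" using F by (auto simp: bad_def)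
  have Fsub: "\<Inter>F \<subseteq> I" using FU Fne UI by blast
  obtain A0 where A0: "A0 \<in> F" using Fne by blast
  \<comment> \<open>Each point outside \<open>\<Inter>F\<close> is sent to a member of \<open>F\<close> missing it, so the fibres are not in \<open>U\<close>.\<close>
  define p where "p i = (if i \<in> \<Inter>F then A0 else (SOME A. A \<in> F \<and> i \<notin> A))" for i
  have p_mem: "p i \<in> F" and p_notin: "i \<notin> \<Inter>F \<Longrightarrow> i \<notin> p i" for i
    using someI_ex[of "\<lambda>A. A \<in> F \<and> i \<notin> A"] A0 by (auto simp: p_def)
  have p_fib: "{i\<in>I. p i = A} \<notin> U" for A
  proof
    assume *: "{i\<in>I. p i = A} \<in> U"
    then have "{i\<in>I. p i = A} \<noteq> {}" using empty_U by metis
    then have A: "A \<in> F" using p_mem by auto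
    \<comment> \<open>A point of the fibre either misses \<open>A\<close> or lies in
      \<open>\<Inter>F\<close>, where \<open>p\<close> has the default value \<open>A0\<close>.
      Since \<open>\<Inter>F\<close> is not in \<open>U\<close>, the set \<open>I - A\<close> would
      be.\<close>
    have "(I - A) \<union> \<Inter>F \<in> U" using p_notin Fsub by (intro up[OF *]) blast+
    then have "I - A \<in> U" using un FN by blast
    then show False using FU[OF A] compl UI by blast
  qed
  \<comment> \<open>If \<open>F\<close> embedded into \<open>C\<close>, composing \<open>p\<close>
    with the embedding would give a map into \<open>C\<close>, and \<open>fib\<close> would put one
    of its fibres, which is a fibre of \<open>p\<close>, into \<open>U\<close>.\<close>
  have CF: "|C| <o |F|"
  proof (rule ccontr)
    assume "\<not> ?thesis"
    then have "|F| \<le>o |C|" by (simp add: not_ordLess_iff_ordLeq)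
    then obtain c where c: "inj_on c F" "c ` F \<subseteq> C" using card_of_ordLeq[of F C] by blast
    then obtain d where "{i\<in>I. c (p i) = d} \<in> U"
      using fib[of "\<lambda>i. c (p i)"] p_mem by blast
    moreover from this obtain j where "j \<in> I" "c (p j) = d" using empty_U by (metis (mono_tags, lifting) empty_Collect_eq)
    then have "{i\<in>I. c (p i) = d} = {i\<in>I. p i = p j}"
      using c(1) p_mem by (auto dest: inj_onD)
    ultimately show False using p_fib by simp
  qed
  \<comment> \<open>The pushforward of \<open>U\<close> along \<open>p\<close> followed by
    \<open>e\<close>.\<close>
  define V where "V = {T. T \<subseteq> e ` F \<and> {i\<in>I. e (p i) \<in> T} \<in> U}"
  have ep: "e (p i) \<in> e ` F" for i using p_mem by auto
  have "ultrafilter_on (e ` F) V"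
    unfolding ultrafilter_on_def
  proof (intro conjI ballI allI impI)
    show "e ` F \<in> V" using I_U ep by (simp add: V_def)
    show "{} \<notin> V" using empty_U by (simp add: V_def)
    show "T \<in> V" if "S \<in> V" "S \<subseteq> T \<and> T \<subseteq> e ` F" for S T
      using that up[of "{i\<in>I. e (p i) \<in> S}" "{i\<in>I. e (p i) \<in> T}"] by (auto simp: V_def)
    show "S \<inter> T \<in> V" if "S \<in> V" "T \<in> V" for S T
    proof -
      have "{i\<in>I. e (p i) \<in> S} \<inter> {i\<in>I. e (p i) \<in> T} \<in> U" using that by (auto simp: V_def intro: int)
      then show ?thesis using that by (auto simp: V_def Collect_conj_eq[symmetric] intro: back_subst[of "\<lambda>x. x \<in> U"])
    qed
    show "S \<in> V \<or> e ` F - S \<in> V" if "S \<subseteq> e ` F" for S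
    proof -
      have "I - {i\<in>I. e (p i) \<in> S} = {i\<in>I. e (p i) \<in> e ` F - S}" using ep by auto
      then show ?thesis using max[of "{i\<in>I. e (p i) \<in> S}"] that by (auto simp: V_def)
    qed
  qed (auto simp: V_def)
  moreover have "nonprincipal_on (e ` F) V"
    unfolding nonprincipal_on_def
  proof
    fix x assume "x \<in> e ` F"
    then obtain A where A: "A \<in> F" "x = e A" by blast
    have "{i\<in>I. e (p i) \<in> {x}} = {i\<in>I. p i = A}"
      using A e(1) p_mem by (auto dest: inj_onD)
    then have "{x} \<notin> V" using p_fib by (simp add: V_def)
    then show "V \<noteq> {S. S \<subseteq> e ` F \<and> x \<in> S}" using \<open>x \<in> e ` F\<close> by blast
  qed
  moreover have "\<Inter>G \<in> V" if G: "G \<subseteq> V" "G \<noteq> {}" "|G| <o |e ` F|" for G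
  proof -
    let ?h = "\<lambda>T. {i\<in>I. e (p i) \<in> T}"
    \<comment> \<open>The preimages form a family with fewer members than \<open>F\<close>, so by
      minimality their intersection stays in \<open>U\<close>.\<close>
    have "\<not> bad (?h ` G)"
    proof
      assume "bad (?h ` G)"
      then have "|F| \<le>o |G|" using Fmin ordLeq_transitive card_of_image by blast
      then show False using G(3) eF by (meson not_ordLess_ordLeq ordLess_ordIso_trans ordIso_symmetric)
    qed
    moreover have "?h ` G \<subseteq> U" using G(1) by (auto simp: V_def)
    ultimately have "\<Inter>(?h ` G) \<in> U" using G(2) by (auto simp: bad_def)
    moreover have "\<Inter>(?h ` G) = ?h (\<Inter>G)" using G(2) by auto
    moreover have "\<Inter>G \<subseteq> e ` F" using G(1,2) unfolding V_def by blast
    ultimately show ?thesis by (simp add: V_def)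
  qed
  ultimately have "measurable_cardinal |e ` F|"
    unfolding measurable_cardinal_def by (auto simp: Field_card_of)
  moreover have "|C| <o |e ` F|" using CF eF by (rule ordLess_ordIso_trans)
  moreover have "|e ` F| \<le>o |I|" using e(2) by (rule card_of_mono1)
  ultimately show ?thesis by blast
qed

section \<open>Atoms modulo an ideal of sets\<close>

locale set_ideal =
  fixes I :: "'i set" and N :: "'i set set"
  assumes empty_mem: "{} \<in> N"
    and subset_mem: "\<lbrakk>S \<in> N; T \<subseteq> S\<rbrakk> \<Longrightarrow> T \<in> N"
    and Un_mem: "\<lbrakk>S \<in> N; T \<in> N\<rbrakk> \<Longrightarrow> S \<union> T \<in> N"
begin

lemma UN_mem: "\<lbrakk>finite A; \<And>x. x \<in> A \<Longrightarrow> S x \<in> N\<rbrakk> \<Longrightarrow> (\<Union>x\<in>A. S x) \<in> N"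
  by (induction A rule: finite_induct) (auto intro: empty_mem Un_mem)

text \<open>Such an \<open>S\<close> is nonzero modulo the ideal generated by \<open>N\<close> and
  the finite sets.\<close>

definition positive :: "'i set \<Rightarrow> bool"
  where "positive S \<longleftrightarrow> S \<subseteq> I \<and> (\<forall>F. finite F \<longrightarrow> S - F \<notin> N)"

lemma positive_mono: "\<lbrakk>positive S; S \<subseteq> T; T \<subseteq> I\<rbrakk> \<Longrightarrow> positive T"
  unfolding positive_def by (meson Diff_mono order_refl subset_mem)

lemma positive_Un:
  assumes "positive (S \<union> T)" shows "positive S \<or> positive T"
proof (rule ccontr)
  assume "\<not> ?thesis"
  then obtain F G where "finite F" "S - F \<in> N" "finite G" "T - G \<in> N"
    using assms unfolding positive_def by blast
  then have "finite (F \<union> G)" "(S - F) \<union> (T - G) \<in> N" by (auto intro: Un_mem)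
  moreover from this have "S \<union> T - (F \<union> G) \<in> N" by (elim subset_mem) auto
  ultimately show False using assms unfolding positive_def by blast
qed

text \<open>Without an atom, repeated splitting of \<open>I\<close> yields infinitely many disjoint
  positive sets. A map to \<open>C\<close> that takes a different constant value on each of them has
  infinitely many positive fibres, against \<open>fib\<close>.\<close>

lemma positive_atom:
  assumes C: "infinite C"
    and fib: "\<And>g. g \<in> I \<rightarrow> C \<Longrightarrow> \<exists>F. finite F \<and> {i\<in>I. g i \<notin> F} \<in> N"
    and pos: "positive I"
  shows "\<exists>S. positive S \<and> (\<forall>T. T \<subseteq> S \<longrightarrow> \<not> (positive T \<and> positive (S - T)))"
proof (rule ccontr)
  assume "\<not> ?thesis"
  then have "\<forall>S. \<exists>T. positive S \<longrightarrow> T \<subseteq> S \<and> positive T \<and> positive (S - T)" by blast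
  then obtain t where t: "\<And>S. positive S \<Longrightarrow> t S \<subseteq> S \<and> positive (t S) \<and> positive (S - t S)" by metis
  define R where "R n = (t ^^ n) I" for n
  have R_pos: "positive (R n)" for n by (induction n) (auto simp: R_def pos t)
  have R_Suc: "R (Suc n) \<subseteq> R n" and R_diff: "positive (R n - R (Suc n))" for n
    using t[OF R_pos[of n]] by (auto simp: R_def)
  obtain e :: "nat \<Rightarrow> _" where e: "inj e" "range e \<subseteq> C"
    using infinite_countable_subset[OF C] by blast
  \<comment> \<open>Labels the difference \<open>R n - R (Suc n)\<close> that contains
    \<open>i\<close>. Points lying in every \<open>R n\<close> get an unspecified label, which is
    harmless because only the inclusion of a difference in a fibre is used.\<close>
  define g where "g i = e (LEAST n. i \<notin> R (Suc n))" for i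
  have "g \<in> I \<rightarrow> C" using e by (auto simp: g_def)
  then obtain F where F: "finite F" "{i\<in>I. g i \<notin> F} \<in> N" using fib by blast
  have "infinite (range e)" using e(1) by (rule range_inj_infinite)
  then obtain n where n: "e n \<notin> F" using F(1) by (metis finite_subset image_subset_iff)
  have "g i = e n" if "i \<in> R n - R (Suc n)" for i
  proof -
    have "(LEAST n. i \<notin> R (Suc n)) = n"
    proof (rule Least_equality)
      show "i \<notin> R (Suc n)" using that by auto
      show "n \<le> m" if m: "i \<notin> R (Suc m)" for m
      proof (rule ccontr)
        assume "\<not> n \<le> m"
        then have "R n \<subseteq> R (Suc m)" using lift_Suc_antimono_le[of R "Suc m" n] R_Suc by simp
        then show False using \<open>i \<in> R n - R (Suc n)\<close> m by auto
      qed
    qed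
    then show ?thesis by (simp add: g_def)
  qed
  moreover have "R n \<subseteq> I" using R_pos by (simp add: positive_def)
  ultimately have "R n - R (Suc n) \<subseteq> {i\<in>I. g i \<notin> F}" using n by auto
  then have "R n - R (Suc n) - {} \<in> N" using F(2) subset_mem by auto
  then show False using R_diff[of n] unfolding positive_def by blast
qed

text \<open>Otherwise \<open>I\<close> is positive and contains an atom \<open>S\<close>. The sets
  meeting \<open>S\<close> in a positive set form a nonprincipal ultrafilter, and the measurable
  cardinal \<open>r\<close> obtained from it satisfies \<open>|C| <o r\<close> and
  \<open>r \<le>o |I|\<close>, contrary to \<open>below\<close>.\<close>

lemma cofinite_mem_of_below_measurables:
  assumes C: "infinite C"
    and fib: "\<And>g. g \<in> I \<rightarrow> C \<Longrightarrow> \<exists>F. finite F \<and> {i\<in>I. g i \<notin> F} \<in> N"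
    and below: "below_measurables_above I C"
  shows "\<exists>F. finite F \<and> I - F \<in> N"
proof (rule ccontr)
  assume "\<not> ?thesis"
  then have "positive I" unfolding positive_def by blast
  from positive_atom[OF C fib this] obtain S
    where S: "positive S" and atom: "\<And>T. T \<subseteq> S \<Longrightarrow> \<not> (positive T \<and> positive (S - T))" by blast
  have SI: "S \<subseteq> I" using S by (simp add: positive_def)
  have fin: "\<not> positive T" if "finite T" for T
    using that empty_mem unfolding positive_def by (metis Diff_cancel)
  define U where "U = {T. T \<subseteq> I \<and> positive (S \<inter> T)}"
  have split: "positive (S \<inter> T) \<or> positive (S - T)" for T
    using positive_Un[of "S \<inter> T" "S - T"] S by (simp add: Int_Diff_Un)
  have not_both: "\<not> (positive (S \<inter> T) \<and> positive (S - T))" for T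
    using atom[of "S \<inter> T"] by (simp add: Diff_Int)
  have "ultrafilter_on I U"
    unfolding ultrafilter_on_def
  proof (intro conjI ballI allI impI)
    show "I \<in> U" using S SI by (simp add: U_def Int_absorb2)
    show "{} \<notin> U" using fin by (simp add: U_def)
    show "T' \<in> U" if "T \<in> U" "T \<subseteq> T' \<and> T' \<subseteq> I" for T T'
      using that SI by (auto simp: U_def intro: positive_mono)
    show "T \<inter> T' \<in> U" if "T \<in> U" "T' \<in> U" for T T'
    proof (rule ccontr)
      assume "T \<inter> T' \<notin> U"
      then have "positive ((S - T) \<union> (S - T'))"
        using that split[of "T \<inter> T'"] by (auto simp: U_def Diff_Int)
      then show False using that not_both[of T] not_both[of T'] positive_Un by (auto simp: U_def)
    qed
    show "T \<in> U \<or> I - T \<in> U" if "T \<subseteq> I" for T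
    proof -
      have "S \<inter> (I - T) = S - T" using SI by auto
      then show ?thesis using that split by (auto simp: U_def)
    qed
  qed (auto simp: U_def)
  moreover have "nonprincipal_on I U"
    unfolding nonprincipal_on_def
  proof
    fix x assume "x \<in> I"
    moreover have "{x} \<notin> U" using fin[of "S \<inter> {x}"] by (simp add: U_def)
    ultimately show "U \<noteq> {S. S \<subseteq> I \<and> x \<in> S}" by blast
  qed
  moreover have "\<exists>c\<in>C. {i\<in>I. g i = c} \<in> U" if g: "g \<in> I \<rightarrow> C" for g
  proof (rule ccontr)
    assume *: "\<not> ?thesis"
    obtain F where F: "finite F" "{i\<in>I. g i \<notin> F} \<in> N" using fib[OF g] by blast
    have np: "\<not> positive (S \<inter> {i\<in>I. g i = c})" for c
    proof (cases "c \<in> C")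
      case True then show ?thesis using * by (auto simp: U_def)
    next
      case False
      then have "S \<inter> {i\<in>I. g i = c} = {}" using g by auto
      then show ?thesis using fin[of "{}"] by simp
    qed
    \<comment> \<open>If no fibre were in \<open>U\<close>, the finitely many fibres over
      \<open>F\<close> and the remaining part, which lies in \<open>N\<close>, would cover
      \<open>S\<close> by sets that are not positive.\<close>
    have "\<not> positive (\<Union>c\<in>F. S \<inter> {i\<in>I. g i = c})"
      using F(1) by (induction F rule: finite_induct) (auto simp: fin np dest: positive_Un)
    moreover have "\<not> positive (S \<inter> {i\<in>I. g i \<notin> F})"
      using subset_mem[OF F(2), of "S \<inter> {i\<in>I. g i \<notin> F} - {}"] unfolding positive_def by blast
    moreover have "(\<Union>c\<in>F. S \<inter> {i\<in>I. g i = c}) \<union> (S \<inter> {i\<in>I. g i \<notin> F}) = S" using SI by auto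
    ultimately show False
      using S positive_Un[of "\<Union>c\<in>F. S \<inter> {i\<in>I. g i = c}" "S \<inter> {i\<in>I. g i \<notin> F}"] by simp
  qed
  ultimately obtain r :: "'i rel" where "measurable_cardinal r" "|C| <o r" "r \<le>o |I|"
    using measurable_cardinal_of_ultrafilter[of I U C] C by blast
  then show False using below by (meson below_measurables_above_def not_ordLess_ordLeq)
qed

end

section \<open>Partial fractions\<close>

lemma (in abelian_group) finsum_minus:
  assumes f: "f \<in> A \<rightarrow> carrier G" and g: "g \<in> A \<rightarrow> carrier G"
  shows "(\<Oplus>x\<in>A. f x \<ominus> g x) = finsum G f A \<ominus> finsum G g A"
proof -
  have d: "(\<lambda>x. f x \<ominus> g x) \<in> A \<rightarrow> carrier G" using f g by auto
  have "finsum G f A = (\<Oplus>x\<in>A. (f x \<ominus> g x) \<oplus> g x)"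
    using f g by (intro finsum_cong') (auto simp: a_minus_def a_assoc l_neg Pi_iff)
  also have "\<dots> = (\<Oplus>x\<in>A. f x \<ominus> g x) \<oplus> finsum G g A"
    using d g by (rule finsum_addf)
  finally show ?thesis
    using d f g by (simp add: a_minus_def a_assoc r_neg)
qed

context field
begin

lemma m_inv_closed: "\<lbrakk>x \<in> carrier R; x \<noteq> \<zero>\<rbrakk> \<Longrightarrow> inv x \<in> carrier R"
  using field_Units by auto

lemma minus_ne_zero: "\<lbrakk>x \<in> carrier R; y \<in> carrier R; x \<noteq> y\<rbrakk> \<Longrightarrow> x \<ominus> y \<noteq> \<zero>"
  by simp

lemma mult_inv_cancel: "\<lbrakk>x \<in> carrier R; x \<noteq> \<zero>\<rbrakk> \<Longrightarrow> x \<otimes> inv x = \<one>"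
  using field_Units by auto

text \<open>Comparing the values at \<open>s\<close> and \<open>t\<close> keeps the pole at
  \<open>l\<close> and produces the factor \<open>t \<ominus> s\<close>, which is the same for all
  poles.\<close>

lemma inv_minus_inv:
  assumes "s \<in> carrier R" "t \<in> carrier R" "l \<in> carrier R" "s \<noteq> l" "t \<noteq> l"
  shows "inv (s \<ominus> l) \<ominus> inv (t \<ominus> l) = (t \<ominus> s) \<otimes> (inv (t \<ominus> l) \<otimes> inv (s \<ominus> l))"
proof -
  define x y where "x = inv (s \<ominus> l)" and "y = inv (t \<ominus> l)"
  have c: "x \<in> carrier R" "y \<in> carrier R" using assms by (auto simp: x_def y_def m_inv_closed)
  have x: "(s \<ominus> l) \<otimes> x = \<one>" and y: "(t \<ominus> l) \<otimes> y = \<one>"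
    using assms by (auto simp: x_def y_def mult_inv_cancel)
  have "(t \<ominus> s) \<otimes> (y \<otimes> x) = ((t \<ominus> l) \<otimes> y) \<otimes> x \<ominus> ((s \<ominus> l) \<otimes> x) \<otimes> y"
    using assms(1-3) c by algebra
  then show ?thesis using c by (simp add: x y flip: x_def y_def)
qed

text \<open>Multiplication by \<open>t \<ominus> l\<close> turns a pole at \<open>m\<close> into a
  constant and a pole with the extra coefficient \<open>m \<ominus> l\<close>, which vanishes
  exactly for \<open>m = l\<close>.\<close>

lemma mult_inv_expand:
  assumes "t \<in> carrier R" "l \<in> carrier R" "m \<in> carrier R" "t \<noteq> m"
  shows "(t \<ominus> l) \<otimes> inv (t \<ominus> m) = \<one> \<oplus> (m \<ominus> l) \<otimes> inv (t \<ominus> m)"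
proof -
  define x where "x = inv (t \<ominus> m)"
  have c: "x \<in> carrier R" using assms by (auto simp: x_def m_inv_closed)
  have x: "(t \<ominus> m) \<otimes> x = \<one>" using assms by (auto simp: x_def mult_inv_cancel)
  have "(t \<ominus> l) \<otimes> x = (t \<ominus> m) \<otimes> x \<oplus> (m \<ominus> l) \<otimes> x" using assms(1-3) c by algebra
  then show ?thesis by (simp add: x flip: x_def)
qed

text \<open>To be read for \<open>t\<close> outside \<open>\<Lambda>\<close>, since
  \<open>inv \<zero>\<close> has no specified value.\<close>

definition partial_fractions :: "'a set \<Rightarrow> ('a \<Rightarrow> 'a) \<Rightarrow> 'a \<Rightarrow> 'a"
  where "partial_fractions \<Lambda> c t = (\<Oplus>l\<in>\<Lambda>. c l \<otimes> inv (t \<ominus> l))"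

lemma partial_fractions_closed:
  assumes "\<Lambda> \<subseteq> carrier R" "c \<in> \<Lambda> \<rightarrow> carrier R" "t \<in> carrier R - \<Lambda>"
  shows "partial_fractions \<Lambda> c t \<in> carrier R"
proof -
  have "c l \<otimes> inv (t \<ominus> l) \<in> carrier R" if "l \<in> \<Lambda>" for l
  proof -
    have "t \<noteq> l" "l \<in> carrier R" "c l \<in> carrier R" using that assms by auto
    then show ?thesis using assms(3) m_inv_closed[of "t \<ominus> l"] by auto
  qed
  then show ?thesis unfolding partial_fractions_def by (intro finsum_closed) auto
qed

text \<open>Induction on the set of poles. Subtracting the value at one of the zeros removes the constant,
  and multiplying by \<open>t \<ominus> l\<close> then removes the pole \<open>l\<close> at the cost of a new constant.\<close>

lemma partial_fractions_zeros:
  assumes "finite \<Lambda>" "\<Lambda> \<subseteq> carrier R" "c \<in> \<Lambda> \<rightarrow> carrier R" "d \<in> carrier R"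
    and "infinite Z" "Z \<subseteq> carrier R - \<Lambda>" "\<And>t. t \<in> Z \<Longrightarrow> d \<oplus> partial_fractions \<Lambda> c t = \<zero>"
  shows "(\<forall>l\<in>\<Lambda>. c l = \<zero>) \<and> d = \<zero>"
  using assms
proof (induction \<Lambda> arbitrary: c d Z rule: finite_induct)
  case empty
  then obtain t where "t \<in> Z" by (metis finite.emptyI equals0I)
  from empty.prems(6)[OF this] show ?case using empty by (simp add: partial_fractions_def)
next
  case (insert m \<Lambda>)
  let ?M = "insert m \<Lambda>"
  have M: "\<And>l. l \<in> ?M \<Longrightarrow> l \<in> carrier R" "\<And>l. l \<in> ?M \<Longrightarrow> c l \<in> carrier R" using insert by auto
  have Z: "t \<in> carrier R" "\<And>l. l \<in> ?M \<Longrightarrow> t \<noteq> l" if "t \<in> Z" for t using insert.prems(5) that by auto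
  have inv: "inv (t \<ominus> l) \<in> carrier R" if "t \<in> Z" "l \<in> ?M" for t l
    using Z[OF that(1)] M(1)[OF that(2)] that(2) m_inv_closed[of "t \<ominus> l"] by auto
  obtain s where s: "s \<in> Z" using insert.prems(4) by (metis finite.emptyI equals0I)
  define c' where "c' l = c l \<otimes> inv (s \<ominus> l)" for l
  have c': "c' l \<in> carrier R" if "l \<in> ?M" for l using that M inv[OF s] by (simp add: c'_def)
  have eq1: "c' m \<otimes> inv (t \<ominus> m) \<oplus> partial_fractions \<Lambda> c' t = \<zero>" if t: "t \<in> Z - {s}" for t
  proof -
    have t': "t \<in> Z" "t \<noteq> s" using t by auto
    have pf: "partial_fractions ?M c u = (\<Oplus>l\<in>?M. c l \<otimes> inv (u \<ominus> l))" for u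
      by (simp add: partial_fractions_def)
    have cl: "partial_fractions ?M c u \<in> carrier R" if "u \<in> Z" for u
      using that insert.prems by (intro partial_fractions_closed) auto
    have "\<zero> = partial_fractions ?M c s \<ominus> partial_fractions ?M c t"
    proof -
      have "d \<oplus> partial_fractions ?M c s = d \<oplus> partial_fractions ?M c t"
        using insert.prems(6) s t' by simp
      then have "partial_fractions ?M c s = partial_fractions ?M c t"
        using cl s t' insert.prems(3) by simp
      then show ?thesis using cl t' by (simp add: r_neg a_minus_def)
    qed
    also have "\<dots> = (\<Oplus>l\<in>?M. c l \<otimes> inv (s \<ominus> l) \<ominus> c l \<otimes> inv (t \<ominus> l))"
      unfolding pf using M inv s t' insert.hyps(1) by (subst finsum_minus) auto
    also have "\<dots> = (\<Oplus>l\<in>?M. (t \<ominus> s) \<otimes> (c' l \<otimes> inv (t \<ominus> l)))"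
    proof (rule finsum_cong', simp)
      show "(\<lambda>l. (t \<ominus> s) \<otimes> (c' l \<otimes> inv (t \<ominus> l))) \<in> ?M \<rightarrow> carrier R"
        using c' inv t' Z s by auto
      fix l assume l: "l \<in> ?M"
      have "c l \<otimes> inv (s \<ominus> l) \<ominus> c l \<otimes> inv (t \<ominus> l) = c l \<otimes> (inv (s \<ominus> l) \<ominus> inv (t \<ominus> l))"
        using M(2)[OF l] inv[OF s l] inv[OF t'(1) l] by algebra
      also have "inv (s \<ominus> l) \<ominus> inv (t \<ominus> l) = (t \<ominus> s) \<otimes> (inv (t \<ominus> l) \<otimes> inv (s \<ominus> l))"
        using Z[OF s] Z[OF t'(1)] M l by (intro inv_minus_inv) auto
      also have "c l \<otimes> \<dots> = (t \<ominus> s) \<otimes> (c' l \<otimes> inv (t \<ominus> l))"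
        unfolding c'_def using M(2)[OF l] inv[OF s l] inv[OF t'(1) l] Z(1)[OF s] Z(1)[OF t'(1)] by algebra
      finally show "c l \<otimes> inv (s \<ominus> l) \<ominus> c l \<otimes> inv (t \<ominus> l) = (t \<ominus> s) \<otimes> (c' l \<otimes> inv (t \<ominus> l))" .
    qed
    also have "\<dots> = (t \<ominus> s) \<otimes> partial_fractions ?M c' t"
      unfolding partial_fractions_def using c' inv t' Z s insert.hyps(1)
      by (subst finsum_rdistr) auto
    finally have "(t \<ominus> s) \<otimes> partial_fractions ?M c' t = \<zero>" by simp
    moreover have "partial_fractions ?M c' t \<in> carrier R"
      using insert.prems c' t' by (intro partial_fractions_closed) auto
    moreover have "t \<ominus> s \<noteq> \<zero>" "t \<ominus> s \<in> carrier R" using t' Z s minus_ne_zero by auto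
    ultimately have "partial_fractions ?M c' t = \<zero>" using integral by blast
    then show ?thesis
      unfolding partial_fractions_def using insert.hyps c' inv t' by (subst (asm) finsum_insert) auto
  qed
  \<comment> \<open>Multiplying \<open>eq1\<close> by \<open>t \<ominus> m\<close> leaves the poles
    in \<open>\<Lambda>\<close> with the coefficients \<open>c''\<close>, while the constants that
    arise add up to \<open>e\<close>.\<close>
  define c'' where "c'' l = (l \<ominus> m) \<otimes> c' l" for l
  define e where "e = c' m \<oplus> (\<Oplus>l\<in>\<Lambda>. c' l)"
  have sum_c': "(\<Oplus>l\<in>\<Lambda>. c' l) \<in> carrier R" using c' by (intro finsum_closed) auto
  have eq2: "e \<oplus> partial_fractions \<Lambda> c'' t = \<zero>" if t: "t \<in> Z - {s}" for t
  proof -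
    have t': "t \<in> Z" "t \<noteq> s" using t by auto
    have pc: "partial_fractions \<Lambda> c' t \<in> carrier R"
      using insert.prems c' t' by (intro partial_fractions_closed) auto
    have tm: "t \<ominus> m \<in> carrier R" "t \<ominus> m \<noteq> \<zero>" using Z t' M minus_ne_zero by auto
    have "\<zero> = (t \<ominus> m) \<otimes> (c' m \<otimes> inv (t \<ominus> m) \<oplus> partial_fractions \<Lambda> c' t)"
      using eq1[OF t] tm by simp
    also have "\<dots> = c' m \<otimes> ((t \<ominus> m) \<otimes> inv (t \<ominus> m)) \<oplus> (t \<ominus> m) \<otimes> partial_fractions \<Lambda> c' t"
      using tm(1) c'[of m] inv[OF t'(1), of m] pc by (simp add: r_distr m_lcomm)
    also have "(t \<ominus> m) \<otimes> inv (t \<ominus> m) = \<one>" using tm by (simp add: mult_inv_cancel)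
    also have "(t \<ominus> m) \<otimes> partial_fractions \<Lambda> c' t = (\<Oplus>l\<in>\<Lambda>. (t \<ominus> m) \<otimes> (c' l \<otimes> inv (t \<ominus> l)))"
      unfolding partial_fractions_def using c' inv t' tm insert.hyps(1)
      by (subst finsum_rdistr) auto
    also have "\<dots> = (\<Oplus>l\<in>\<Lambda>. c' l \<oplus> c'' l \<otimes> inv (t \<ominus> l))"
    proof (rule finsum_cong', simp)
      show "(\<lambda>l. c' l \<oplus> c'' l \<otimes> inv (t \<ominus> l)) \<in> \<Lambda> \<rightarrow> carrier R"
        using c' inv t' M by (auto simp: c''_def)
      fix l assume l: "l \<in> \<Lambda>"
      have "(t \<ominus> m) \<otimes> (c' l \<otimes> inv (t \<ominus> l)) = c' l \<otimes> ((t \<ominus> m) \<otimes> inv (t \<ominus> l))"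
        using tm(1) c'[of l] inv[OF t'(1), of l] l by (simp add: m_lcomm)
      also have "(t \<ominus> m) \<otimes> inv (t \<ominus> l) = \<one> \<oplus> (l \<ominus> m) \<otimes> inv (t \<ominus> l)"
        using Z[OF t'(1)] M l by (intro mult_inv_expand) auto
      also have "c' l \<otimes> \<dots> = c' l \<oplus> c'' l \<otimes> inv (t \<ominus> l)"
        unfolding c''_def using c'[of l] inv[OF t'(1), of l] l M(1)[of l] M(1)[of m]
        by (simp add: r_distr m_assoc m_lcomm)
      finally show "(t \<ominus> m) \<otimes> (c' l \<otimes> inv (t \<ominus> l)) = c' l \<oplus> c'' l \<otimes> inv (t \<ominus> l)" .
    qed
    also have "\<dots> = (\<Oplus>l\<in>\<Lambda>. c' l) \<oplus> partial_fractions \<Lambda> c'' t"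
      unfolding partial_fractions_def
      using c' inv t' M by (intro finsum_addf) (auto simp: c''_def)
    finally show ?thesis
      using c'[of m] sum_c' partial_fractions_closed[of \<Lambda> c'' t] insert.prems c' t' M
      by (auto simp: e_def c''_def Pi_iff a_assoc)
  qed
  have "(\<forall>l\<in>\<Lambda>. c'' l = \<zero>) \<and> e = \<zero>"
  proof (rule insert.IH)
    show "infinite (Z - {s})" using insert.prems(4) by simp
    show "e \<in> carrier R" using c'[of m] sum_c' by (simp add: e_def)
    show "c'' \<in> \<Lambda> \<rightarrow> carrier R" using c' M by (auto simp: c''_def)
  qed (use insert.prems eq2 in auto)
  then have c''0: "\<And>l. l \<in> \<Lambda> \<Longrightarrow> c'' l = \<zero>" and e0: "e = \<zero>" by auto
  \<comment> \<open>The two transformations are undone: \<open>l \<ominus> m\<close> is nonzero on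
    \<open>\<Lambda>\<close>, so \<open>c'\<close> vanishes there; then \<open>e\<close> reduces to
    \<open>c' m\<close>; and the factors \<open>inv (s \<ominus> l)\<close> are nonzero.\<close>
  have c'0: "c' l = \<zero>" if l: "l \<in> \<Lambda>" for l
  proof -
    have "l \<ominus> m \<noteq> \<zero>" using l M insert.hyps minus_ne_zero[of l m] by auto
    then show ?thesis using c''0[OF l] c'[of l] l M integral[of "l \<ominus> m" "c' l"] by (auto simp: c''_def)
  qed
  then have "(\<Oplus>l\<in>\<Lambda>. c' l) = \<zero>" by (simp add: finsum_all0)
  then have "c' m = \<zero>" using e0 c'[of m] by (simp add: e_def)
  then have c'0: "c' l = \<zero>" if "l \<in> ?M" for l using that c'0 by auto
  have c0: "c l = \<zero>" if l: "l \<in> ?M" for l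
  proof -
    have "(s \<ominus> l) \<otimes> inv (s \<ominus> l) = \<one>"
      using Z[OF s] M l minus_ne_zero[of s l] by (simp add: mult_inv_cancel)
    then have "inv (s \<ominus> l) \<noteq> \<zero>" using Z(1)[OF s] M(1)[OF l] by auto
    then show ?thesis using c'0[OF l] M(2)[OF l] inv[OF s l] integral by (auto simp: c'_def)
  qed
  then have "partial_fractions ?M c s = \<zero>"
    unfolding partial_fractions_def using inv[OF s] by (intro finsum_all0) auto
  then show ?case using insert.prems(6)[OF s] insert.prems(3) c0 by simp
qed

end

section \<open>Families larger than a basis\<close>

context vectorspace
begin

text \<open>More than \<open>card T\<close> distinct vectors in the span of \<open>T\<close> are
  dependent by the exchange lemma. The relation is indexed by \<open>A\<close> and not by vectors,
  so a repeated value is treated apart, through the difference of its two occurrences.\<close>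

lemma infinite_family_in_fin_span_dependent:
  assumes T: "finite T" "T \<subseteq> carrier V" and A: "infinite A" and v: "v \<in> A \<rightarrow> span T"
  shows "\<exists>F c. finite F \<and> F \<subseteq> A \<and> c \<in> F \<rightarrow> carrier K \<and>
    (\<Oplus>\<^bsub>V\<^esub>l\<in>F. c l \<odot>\<^bsub>V\<^esub> v l) = \<zero>\<^bsub>V\<^esub> \<and> (\<exists>l\<in>F. c l \<noteq> \<zero>\<^bsub>K\<^esub>)"
proof (cases "inj_on v A")
  case False
  then obtain x y where xy: "x \<in> A" "y \<in> A" "x \<noteq> y" "v x = v y" by (auto simp: inj_on_def)
  have vx: "v x \<in> carrier V" using v xy span_is_subset2[OF T(2)] by auto
  let ?c = "\<lambda>l. if l = x then \<one>\<^bsub>K\<^esub> else \<ominus>\<^bsub>K\<^esub> \<one>\<^bsub>K\<^esub>"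
  have "(\<Oplus>\<^bsub>V\<^esub>l\<in>{x, y}. ?c l \<odot>\<^bsub>V\<^esub> v l) = \<zero>\<^bsub>V\<^esub>"
    using xy vx by (simp add: smult_l_minus M.r_neg)
  then show ?thesis
    using xy by (intro exI[of _ "{x, y}"] exI[of _ ?c]) auto
next
  case True
  then have "infinite (v ` A)" using A finite_imageD by blast
  then obtain W where W: "finite W" "card W = Suc (card T)" "W \<subseteq> v ` A"
    using infinite_arbitrarily_large by blast
  have WT: "W \<subseteq> span T" using W(3) v by auto
  have WV: "W \<subseteq> carrier V" using WT span_is_subset2[OF T(2)] by auto
  have "lin_dep W"
  proof (rule ccontr)
    assume "\<not> lin_dep W"
    from replacement[OF W(1) T this WT] W(2) show False by auto
  qed
  from finite_lin_dep[OF W(1) this WV] obtain a w where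
    a: "a \<in> W \<rightarrow> carrier K" "lincomb a W = \<zero>\<^bsub>V\<^esub>" "w \<in> W" "a w \<noteq> \<zero>\<^bsub>K\<^esub>" by blast
  obtain F where F: "F \<subseteq> A" "inj_on v F" "v ` F = W"
    using W(3) True by (metis subset_image_inj)
  have "finite F" using F(2,3) W(1) finite_imageD by blast
  have "(\<Oplus>\<^bsub>V\<^esub>l\<in>F. a (v l) \<odot>\<^bsub>V\<^esub> v l) = lincomb a W"
    unfolding lincomb_def F(3)[symmetric]
    by (rule M.finsum_reindex[symmetric]) (use F a WV in \<open>auto simp: image_subset_iff Pi_iff\<close>)
  moreover have "(\<lambda>l. a (v l)) \<in> F \<rightarrow> carrier K" "\<exists>l\<in>F. a (v l) \<noteq> \<zero>\<^bsub>K\<^esub>"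
    using F(3) a(1,3,4) by auto
  ultimately show ?thesis
    using F(1) \<open>finite F\<close> a(2) by (intro exI[of _ F] exI[of _ "\<lambda>l. a (v l)"]) simp
qed

lemma ex_finite_support:
  assumes "basis S" "b \<in> carrier V"
  shows "\<exists>A a. finite A \<and> A \<subseteq> S \<and> a \<in> A \<rightarrow> carrier K \<and> b = lincomb a A"
  using assms unfolding basis_def span_def by blast

text \<open>Each \<open>v l\<close> lies in the span of a finite subset of \<open>S\<close>, and
  there are too few such subsets for the index set \<open>A\<close>: one of them serves infinitely
  many \<open>l\<close>, which reduces the claim to a finite-dimensional span.\<close>

lemma family_larger_than_basis_dependent:
  assumes S: "basis S" "|S| <o |A|" and A: "infinite A" and v: "v \<in> A \<rightarrow> carrier V"
  shows "\<exists>F c. finite F \<and> F \<subseteq> A \<and> c \<in> F \<rightarrow> carrier K \<and>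
    (\<Oplus>\<^bsub>V\<^esub>l\<in>F. c l \<odot>\<^bsub>V\<^esub> v l) = \<zero>\<^bsub>V\<^esub> \<and> (\<exists>l\<in>F. c l \<noteq> \<zero>\<^bsub>K\<^esub>)"
proof -
  have "\<exists>T. T \<in> Fpow S \<and> v l \<in> span T" if "l \<in> A" for l
  proof -
    have "v l \<in> carrier V" using v that by auto
    from ex_finite_support[OF S(1) this] obtain T a
      where "finite T" "T \<subseteq> S" "a \<in> T \<rightarrow> carrier K" "v l = lincomb a T" by blast
    then have "T \<in> Fpow S" "v l \<in> span T" by (auto simp: Fpow_def span_def)
    then show ?thesis by blast
  qed
  then obtain supp where supp: "\<And>l. l \<in> A \<Longrightarrow> supp l \<in> Fpow S \<and> v l \<in> span (supp l)" by metis
  have "\<exists>T\<in>Fpow S. infinite {l\<in>A. supp l = T}"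
  proof (rule ccontr)
    assume "\<not> ?thesis"
    then have fin: "\<And>T. T \<in> Fpow S \<Longrightarrow> finite {l\<in>A. supp l = T}" by blast
    \<comment> \<open>If each \<open>T\<close> served only finitely many indices, \<open>A\<close>
      would be finite for finite \<open>S\<close>. For infinite \<open>S\<close> it would have at
      most \<open>|S|\<close> elements, since \<open>S\<close> has only \<open>|S|\<close> finite
      subsets.\<close>
    have AU: "A = (\<Union>T\<in>Fpow S. {l\<in>A. supp l = T})" using supp by auto
    show False
    proof (cases "finite S")
      case True
      then have "finite (Fpow S)" 
        by (metis Fpow_subset_Pow finite_Pow_iff finite_subset)
      then have "finite (\<Union>T\<in>Fpow S. {l\<in>A. supp l = T})" using fin by (rule finite_UN_I)
      then show False using AU A by metis
    next
      case False
      then have "|Fpow S| =o |S|" by (rule card_of_Fpow_infinite)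
      then have "|\<Union>T\<in>Fpow S. {l\<in>A. supp l = T}| \<le>o |S|"
        using False fin by (intro card_of_UNION_ordLeq_infinite)
          (auto intro: ordIso_imp_ordLeq ordLess_imp_ordLeq finite_ordLess_infinite2)
      then show False using S(2) AU by (metis not_ordLess_ordLeq)
    qed
  qed
  then obtain T where T: "T \<in> Fpow S" "infinite {l\<in>A. supp l = T}" by blast
  have "finite T" "T \<subseteq> carrier V" using T(1) S(1) by (auto simp: Fpow_def basis_def)
  moreover have "v \<in> {l\<in>A. supp l = T} \<rightarrow> span T" using supp by auto
  ultimately have "\<exists>F c. finite F \<and> F \<subseteq> {l\<in>A. supp l = T} \<and> c \<in> F \<rightarrow> carrier K \<and>
    (\<Oplus>\<^bsub>V\<^esub>l\<in>F. c l \<odot>\<^bsub>V\<^esub> v l) = \<zero>\<^bsub>V\<^esub> \<and> (\<exists>l\<in>F. c l \<noteq> \<zero>\<^bsub>K\<^esub>)"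
    using T(2) by (intro infinite_family_in_fin_span_dependent)
  moreover have "{l\<in>A. supp l = T} \<subseteq> A" by blast
  ultimately show ?thesis by (meson subset_trans)
qed

text \<open>A vector is determined by a finite set of pairs of a coefficient and a basis vector, and
  an infinite set has as many finite subsets as elements. The disjoint sum is a bound that avoids
  comparing \<open>carrier K\<close> with \<open>S\<close>.\<close>

lemma card_carrier_le:
  assumes S: "basis S" and K: "infinite (carrier K)"
  shows "|carrier V| \<le>o |carrier K <+> S|"
proof -
  let ?Y = "carrier K <+> S" and ?h = "\<lambda>X. \<Oplus>\<^bsub>V\<^esub>p\<in>X. fst p \<odot>\<^bsub>V\<^esub> snd p"
  have Y: "infinite ?Y" using K by auto
  have "carrier V \<subseteq> ?h ` Fpow (carrier K \<times> S)"
  proof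
    fix b assume "b \<in> carrier V"
    from ex_finite_support[OF S this] obtain A a
      where A: "finite A" "A \<subseteq> S" "a \<in> A \<rightarrow> carrier K" "b = lincomb a A" by blast
    have "a s \<in> carrier K" "s \<in> carrier V" if "s \<in> A" for s
      using that A S by (auto simp: basis_def)
    then have "b = ?h ((\<lambda>s. (a s, s)) ` A)"
      unfolding A(4) lincomb_def
      by (subst M.finsum_reindex) (auto simp: inj_on_def)
    then show "b \<in> ?h ` Fpow (carrier K \<times> S)" using A by (auto simp: Fpow_def)
  qed
  then have "|carrier V| \<le>o |Fpow (carrier K \<times> S)|"
    by (rule ordLeq_transitive[OF card_of_mono1 card_of_image])
  also have "|Fpow (carrier K \<times> S)| \<le>o |Fpow (?Y \<times> ?Y)|"
  proof (rule card_of_Fpow_mono)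
    have "|carrier K \<times> S| \<le>o |?Y \<times> S|" by (rule card_of_Times_mono1[OF card_of_Plus1])
    also have "|?Y \<times> S| \<le>o |?Y \<times> ?Y|" by (rule card_of_Times_mono2[OF card_of_Plus2])
    finally show "|carrier K \<times> S| \<le>o |?Y \<times> ?Y|" .
  qed
  also have "|Fpow (?Y \<times> ?Y)| =o |?Y \<times> ?Y|"
    using Y by (intro card_of_Fpow_infinite) (auto simp: finite_cartesian_product_iff)
  also have "|?Y \<times> ?Y| =o |?Y|" using Y by (rule card_of_Times_same_infinite)
  finally show ?thesis .
qed

end

text \<open>A set of naturals is turned into the sequence of codes of its initial segments. Sets
  that differ at \<open>m\<close> have different initial segments beyond \<open>m\<close>, so their
  sequences agree at finitely many indices only.\<close>

lemma eventually_different_family: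
  assumes I: "|I| =o natLeq" and C: "infinite C"
  shows "\<exists>g. \<forall>r :: nat set. g r \<in> I \<rightarrow> C \<and> (\<forall>s. r \<noteq> s \<longrightarrow> finite {i\<in>I. g r i = g s i})"
proof -
  have "|I| =o |UNIV :: nat set|"
    using I card_of_nat ordIso_symmetric ordIso_transitive by blast
  then obtain b where b: "bij_betw b I (UNIV :: nat set)" using card_of_ordIso by blast
  obtain e :: "nat \<Rightarrow> _" where e: "inj e" "range e \<subseteq> C"
    using infinite_countable_subset[OF C] by blast
  define g where "g r i = e (set_encode (r \<inter> {..<b i}))" for r i
  have "finite {i\<in>I. g r i = g s i}" if rs: "r \<noteq> s" for r s
  proof -
    obtain m where m: "m \<in> r \<longleftrightarrow> m \<notin> s" using rs by blast
    have "b i \<le> m" if "i \<in> I" "g r i = g s i" for i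
    proof (rule ccontr)
      assume bi: "\<not> b i \<le> m"
      have "set_encode (r \<inter> {..<b i}) = set_encode (s \<inter> {..<b i})"
        using that(2) e(1) by (simp add: g_def inj_eq)
      then have "r \<inter> {..<b i} = s \<inter> {..<b i}"
        by (metis finite_Int finite_lessThan set_encode_inverse)
      then have "m \<in> r \<inter> {..<b i} \<longleftrightarrow> m \<in> s \<inter> {..<b i}" by simp
      then show False using m bi by simp
    qed
    then have "b ` {i\<in>I. g r i = g s i} \<subseteq> {..m}" by auto
    moreover have "inj_on b {i\<in>I. g r i = g s i}"
      using b by (auto simp: bij_betw_def intro: inj_on_subset)
    ultimately show ?thesis by (metis finite_atMost finite_subset finite_imageD)
  qed
  moreover have "g r \<in> I \<rightarrow> C" for r using e(2) by (auto simp: g_def)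
  ultimately show ?thesis by blast
qed

section \<open>Lie algebras\<close>

context lie_algebra
begin

lemma zero_bracket [simp]: "x \<in> carrier L \<Longrightarrow> \<zero>\<^bsub>L\<^esub> \<otimes>\<^bsub>L\<^esub> x = \<zero>\<^bsub>L\<^esub>"
  using bracket_smult_left[of "\<zero>\<^bsub>K\<^esub>" "\<zero>\<^bsub>L\<^esub>" x] bracket_closed[of "\<zero>\<^bsub>L\<^esub>" x] by simp

lemma bracket_zero [simp]: "x \<in> carrier L \<Longrightarrow> x \<otimes>\<^bsub>L\<^esub> \<zero>\<^bsub>L\<^esub> = \<zero>\<^bsub>L\<^esub>"
  using bracket_smult_right[of "\<zero>\<^bsub>K\<^esub>" x "\<zero>\<^bsub>L\<^esub>"] bracket_closed[of x "\<zero>\<^bsub>L\<^esub>"] by simp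

text \<open>Polarization of \<open>bracket_self\<close>.\<close>

lemma bracket_anticomm:
  assumes "x \<in> carrier L" "y \<in> carrier L"
  shows "x \<otimes>\<^bsub>L\<^esub> y \<oplus>\<^bsub>L\<^esub> y \<otimes>\<^bsub>L\<^esub> x = \<zero>\<^bsub>L\<^esub>"
proof -
  have "(x \<oplus>\<^bsub>L\<^esub> y) \<otimes>\<^bsub>L\<^esub> (x \<oplus>\<^bsub>L\<^esub> y) = x \<otimes>\<^bsub>L\<^esub> y \<oplus>\<^bsub>L\<^esub> y \<otimes>\<^bsub>L\<^esub> x"
    using assms
    by (simp add: bracket_add_left bracket_add_right bracket_closed
        bracket_self[OF assms(1)] bracket_self[OF assms(2)] M.add.m_comm)
  then show ?thesis using assms bracket_self[of "x \<oplus>\<^bsub>L\<^esub> y"] by simp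
qed

end

text \<open>Restricts \<open>L\<close> to the plain record type on which \<open>lie_center\<close>,
  \<open>bracket_span\<close> and the two series are defined.\<close>

locale lie_algebra_over = lie_algebra K L
  for K :: "('k, 'm) ring_scheme" and L :: "('k, 'a) module"
begin

lemma lie_center_carrier: "z \<in> lie_center L \<Longrightarrow> z \<in> carrier L"
  by (simp add: lie_center_def)

lemma lie_center_bracket: "\<lbrakk>z \<in> lie_center L; x \<in> carrier L\<rbrakk> \<Longrightarrow> z \<otimes>\<^bsub>L\<^esub> x = \<zero>\<^bsub>L\<^esub>"
  by (simp add: lie_center_def)

lemma bracket_lie_center:
  assumes "z \<in> lie_center L" "x \<in> carrier L"
  shows "x \<otimes>\<^bsub>L\<^esub> z = \<zero>\<^bsub>L\<^esub>"
  using bracket_anticomm[of x z] assms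
  by (simp add: lie_center_carrier lie_center_bracket bracket_closed)

lemma submodule_lie_center: "submodule K (lie_center L) L"
proof (rule submodule.intro)
  show "module K L" by unfold_locales
qed (auto simp: lie_center_def bracket_add_left bracket_smult_left)

lemmas lie_center_zero = submodule.zero_closed[OF submodule_lie_center]
  and lie_center_add = submodule.m_closed[OF submodule_lie_center]
  and lie_center_smult = submodule.smult_closed[OF submodule_lie_center]

lemma bracket_span_submodule:
  assumes "S \<subseteq> carrier L" "T \<subseteq> carrier L"
  shows "submodule K (bracket_span K L S T) L"
proof -
  have "{x \<otimes>\<^bsub>L\<^esub> y | x y. x \<in> S \<and> y \<in> T} \<subseteq> carrier L" using assms bracket_closed by blast
  then show ?thesis unfolding bracket_span_def by (rule span_is_submodule)
qed

lemma bracket_in_bracket_span: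
  assumes "S \<subseteq> carrier L" "T \<subseteq> carrier L" "x \<in> S" "y \<in> T"
  shows "x \<otimes>\<^bsub>L\<^esub> y \<in> bracket_span K L S T"
proof -
  have "{x \<otimes>\<^bsub>L\<^esub> y | x y. x \<in> S \<and> y \<in> T} \<subseteq> carrier L" using assms bracket_closed by blast
  from in_own_span[OF this] show ?thesis unfolding bracket_span_def using assms by blast
qed

lemma bracket_span_least:
  assumes "submodule K M L" "\<And>x y. \<lbrakk>x \<in> S; y \<in> T\<rbrakk> \<Longrightarrow> x \<otimes>\<^bsub>L\<^esub> y \<in> M"
  shows "bracket_span K L S T \<subseteq> M"
  unfolding bracket_span_def using assms by (intro span_is_subset) auto

lemma bracket_span_eq_zero:
  assumes "S \<subseteq> carrier L" "T \<subseteq> carrier L" "\<And>x y. \<lbrakk>x \<in> S; y \<in> T\<rbrakk> \<Longrightarrow> x \<otimes>\<^bsub>L\<^esub> y = \<zero>\<^bsub>L\<^esub>"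
  shows "bracket_span K L S T = {\<zero>\<^bsub>L\<^esub>}"
proof
  have "submodule K {\<zero>\<^bsub>L\<^esub>} L"
  proof (rule submodule.intro)
    show "module K L" by unfold_locales
  qed auto
  then show "bracket_span K L S T \<subseteq> {\<zero>\<^bsub>L\<^esub>}" using assms(3) by (intro bracket_span_least) auto
  show "{\<zero>\<^bsub>L\<^esub>} \<subseteq> bracket_span K L S T"
    using submodule.zero_closed[OF bracket_span_submodule[OF assms(1,2)]] by simp
qed

lemma derived_series_carrier: "derived_series K L n \<subseteq> carrier L"
proof (induction n)
  case (Suc n)
  show ?case using submodule.subset[OF bracket_span_submodule[OF Suc Suc]] by simp
qed simp

lemma lower_central_series_carrier: "lower_central_series K L n \<subseteq> carrier L"
proof (induction n)
  case (Suc n)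
  show ?case using submodule.subset[OF bracket_span_submodule[OF subset_refl Suc]] by simp
qed simp

text \<open>Allows finitely many factors of different derived lengths to share one exponent.\<close>

lemma derived_series_stays_zero:
  assumes "derived_series K L m = {\<zero>\<^bsub>L\<^esub>}" "m \<le> n"
  shows "derived_series K L n = {\<zero>\<^bsub>L\<^esub>}"
proof -
  have "bracket_span K L {\<zero>\<^bsub>L\<^esub>} {\<zero>\<^bsub>L\<^esub>} = {\<zero>\<^bsub>L\<^esub>}" by (rule bracket_span_eq_zero) auto
  with assms(2) show ?thesis by (induction n rule: dec_induct) (simp_all add: assms(1))
qed

lemma lower_central_series_stays_zero:
  assumes "lower_central_series K L m = {\<zero>\<^bsub>L\<^esub>}" "m \<le> n"
  shows "lower_central_series K L n = {\<zero>\<^bsub>L\<^esub>}"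
proof -
  have "bracket_span K L (carrier L) {\<zero>\<^bsub>L\<^esub>} = {\<zero>\<^bsub>L\<^esub>}" by (rule bracket_span_eq_zero) auto
  with assms(2) show ?thesis by (induction n rule: dec_induct) (simp_all add: assms(1))
qed

end

section \<open>Homomorphic images of products\<close>

locale lie_product_map = B: lie_algebra_over K B
  for K :: "('k, 'm) ring_scheme" and I :: "'i set" and L :: "'i \<Rightarrow> ('k, 'a) module"
    and B :: "('k, 'b) module" and f :: "('i \<Rightarrow> 'a) \<Rightarrow> 'b" +
  assumes L: "\<And>i. i \<in> I \<Longrightarrow> lie_algebra K (L i)"
    and f: "f \<in> lie_hom K (lie_prod I L) B"
    and f_surj: "f ` carrier (lie_prod I L) = carrier B"
begin

abbreviation P where "P \<equiv> lie_prod I L"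

lemma P_simps:
  "carrier P = (\<Pi>\<^sub>E i\<in>I. carrier (L i))"
  "x \<otimes>\<^bsub>P\<^esub> y = (\<lambda>i\<in>I. x i \<otimes>\<^bsub>L i\<^esub> y i)"
  "x \<oplus>\<^bsub>P\<^esub> y = (\<lambda>i\<in>I. x i \<oplus>\<^bsub>L i\<^esub> y i)"
  "c \<odot>\<^bsub>P\<^esub> x = (\<lambda>i\<in>I. c \<odot>\<^bsub>L i\<^esub> x i)"
  by (simp_all add: lie_prod_def)

lemma L_closed:
  assumes i: "i \<in> I"
  shows "\<zero>\<^bsub>L i\<^esub> \<in> carrier (L i)"
    and "\<lbrakk>x \<in> carrier (L i); y \<in> carrier (L i)\<rbrakk> \<Longrightarrow> x \<oplus>\<^bsub>L i\<^esub> y \<in> carrier (L i)"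
    and "\<lbrakk>x \<in> carrier (L i); y \<in> carrier (L i)\<rbrakk> \<Longrightarrow> x \<otimes>\<^bsub>L i\<^esub> y \<in> carrier (L i)"
    and "\<lbrakk>c \<in> carrier K; x \<in> carrier (L i)\<rbrakk> \<Longrightarrow> c \<odot>\<^bsub>L i\<^esub> x \<in> carrier (L i)"
proof -
  interpret Li: lie_algebra K "L i" by (rule L[OF i])
  show "\<zero>\<^bsub>L i\<^esub> \<in> carrier (L i)" by simp
  show "\<lbrakk>x \<in> carrier (L i); y \<in> carrier (L i)\<rbrakk> \<Longrightarrow> x \<oplus>\<^bsub>L i\<^esub> y \<in> carrier (L i)" by simp
  show "\<lbrakk>x \<in> carrier (L i); y \<in> carrier (L i)\<rbrakk> \<Longrightarrow> x \<otimes>\<^bsub>L i\<^esub> y \<in> carrier (L i)" by (rule Li.bracket_closed)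
  show "\<lbrakk>c \<in> carrier K; x \<in> carrier (L i)\<rbrakk> \<Longrightarrow> c \<odot>\<^bsub>L i\<^esub> x \<in> carrier (L i)" by simp
qed

lemma P_closed:
  "\<lbrakk>x \<in> carrier P; y \<in> carrier P\<rbrakk> \<Longrightarrow> x \<oplus>\<^bsub>P\<^esub> y \<in> carrier P"
  "\<lbrakk>x \<in> carrier P; y \<in> carrier P\<rbrakk> \<Longrightarrow> x \<otimes>\<^bsub>P\<^esub> y \<in> carrier P"
  "\<lbrakk>c \<in> carrier K; x \<in> carrier P\<rbrakk> \<Longrightarrow> c \<odot>\<^bsub>P\<^esub> x \<in> carrier P"
  by (auto simp: P_simps L_closed PiE_iff)

lemma P_component: "\<lbrakk>x \<in> carrier P; i \<in> I\<rbrakk> \<Longrightarrow> x i \<in> carrier (L i)"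
  by (auto simp: P_simps)

lemma f_closed [simp]: "x \<in> carrier P \<Longrightarrow> f x \<in> carrier B"
  and f_add: "\<lbrakk>x \<in> carrier P; y \<in> carrier P\<rbrakk> \<Longrightarrow> f (x \<oplus>\<^bsub>P\<^esub> y) = f x \<oplus>\<^bsub>B\<^esub> f y"
  and f_smult: "\<lbrakk>c \<in> carrier K; x \<in> carrier P\<rbrakk> \<Longrightarrow> f (c \<odot>\<^bsub>P\<^esub> x) = c \<odot>\<^bsub>B\<^esub> f x"
  and f_bracket: "\<lbrakk>x \<in> carrier P; y \<in> carrier P\<rbrakk> \<Longrightarrow> f (x \<otimes>\<^bsub>P\<^esub> y) = f x \<otimes>\<^bsub>B\<^esub> f y"
  using f by (auto simp: lie_hom_def module_hom_def)

text \<open>Such an \<open>x\<close> equals its multiple by zero. The product is never shown to be a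
  vector space; all computations in it go factor by factor.\<close>

lemma f_zero:
  assumes "x \<in> carrier P" "\<And>i. i \<in> I \<Longrightarrow> x i = \<zero>\<^bsub>L i\<^esub>"
  shows "f x = \<zero>\<^bsub>B\<^esub>"
proof -
  have "\<zero>\<^bsub>K\<^esub> \<odot>\<^bsub>P\<^esub> x = x"
  proof
    fix i
    show "(\<zero>\<^bsub>K\<^esub> \<odot>\<^bsub>P\<^esub> x) i = x i"
    proof (cases "i \<in> I")
      case True
      then interpret Li: lie_algebra K "L i" by (rule L)
      show ?thesis using True assms(2) by (simp add: P_simps)
    qed (use assms(1) in \<open>auto simp: P_simps\<close>)
  qed
  then show ?thesis using f_smult[of "\<zero>\<^bsub>K\<^esub>" x] assms(1) by simp
qed

section \<open>The action of functions from \<open>I\<close> to \<open>K\<close> on the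
  product\<close>

definition act :: "('i \<Rightarrow> 'k) \<Rightarrow> ('i \<Rightarrow> 'a) \<Rightarrow> 'i \<Rightarrow> 'a"
  where "act g x = (\<lambda>i\<in>I. g i \<odot>\<^bsub>L i\<^esub> x i)"

lemma act_closed [simp]: "\<lbrakk>g \<in> I \<rightarrow> carrier K; x \<in> carrier P\<rbrakk> \<Longrightarrow> act g x \<in> carrier P"
  by (auto simp: act_def P_simps L_closed Pi_iff PiE_iff)

lemma act_cong: "(\<And>i. i \<in> I \<Longrightarrow> g i = h i) \<Longrightarrow> act g x = act h x"
  by (simp add: act_def cong: restrict_cong)

lemma act_bracket:
  assumes "g \<in> I \<rightarrow> carrier K" "x \<in> carrier P" "y \<in> carrier P"
  shows "act g x \<otimes>\<^bsub>P\<^esub> y = x \<otimes>\<^bsub>P\<^esub> act g y"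
proof
  fix i
  show "(act g x \<otimes>\<^bsub>P\<^esub> y) i = (x \<otimes>\<^bsub>P\<^esub> act g y) i"
  proof (cases "i \<in> I")
    case True
    then interpret Li: lie_algebra K "L i" by (rule L)
    show ?thesis
      using True assms by (simp add: act_def P_simps Li.bracket_smult_left Li.bracket_smult_right PiE_iff Pi_iff)
  qed (simp add: P_simps)
qed

lemma act_act:
  assumes "g \<in> I \<rightarrow> carrier K" "h \<in> I \<rightarrow> carrier K" "x \<in> carrier P"
  shows "act g (act h x) = act (\<lambda>i. g i \<otimes>\<^bsub>K\<^esub> h i) x"
proof
  fix i
  show "act g (act h x) i = act (\<lambda>i. g i \<otimes>\<^bsub>K\<^esub> h i) x i"
  proof (cases "i \<in> I")
    case True
    then interpret Li: lie_algebra K "L i" by (rule L)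
    show ?thesis using True assms by (simp add: act_def P_simps Li.smult_assoc1 PiE_iff Pi_iff)
  qed (simp add: act_def)
qed

lemma act_add:
  assumes "g \<in> I \<rightarrow> carrier K" "h \<in> I \<rightarrow> carrier K" "x \<in> carrier P"
  shows "act (\<lambda>i. g i \<oplus>\<^bsub>K\<^esub> h i) x = act g x \<oplus>\<^bsub>P\<^esub> act h x"
proof
  fix i
  show "act (\<lambda>i. g i \<oplus>\<^bsub>K\<^esub> h i) x i = (act g x \<oplus>\<^bsub>P\<^esub> act h x) i"
  proof (cases "i \<in> I")
    case True
    then interpret Li: lie_algebra K "L i" by (rule L)
    show ?thesis using True assms by (simp add: act_def P_simps Li.smult_l_distr PiE_iff Pi_iff)
  qed (simp add: act_def P_simps)
qed

lemma act_smult: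
  assumes "c \<in> carrier K" "g \<in> I \<rightarrow> carrier K" "x \<in> carrier P"
  shows "act (\<lambda>i. c \<otimes>\<^bsub>K\<^esub> g i) x = c \<odot>\<^bsub>P\<^esub> act g x"
proof
  fix i
  show "act (\<lambda>i. c \<otimes>\<^bsub>K\<^esub> g i) x i = (c \<odot>\<^bsub>P\<^esub> act g x) i"
  proof (cases "i \<in> I")
    case True
    then interpret Li: lie_algebra K "L i" by (rule L)
    show ?thesis using True assms by (simp add: act_def P_simps Li.smult_assoc1 PiE_iff Pi_iff)
  qed (simp add: act_def P_simps)
qed

lemma f_act_zero:
  assumes "x \<in> carrier P" "g \<in> I \<rightarrow> carrier K" "\<And>i. i \<in> I \<Longrightarrow> g i = \<zero>\<^bsub>K\<^esub>"
  shows "f (act g x) = \<zero>\<^bsub>B\<^esub>"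
proof (rule f_zero)
  show "act g x i = \<zero>\<^bsub>L i\<^esub>" if "i \<in> I" for i
  proof -
    interpret Li: lie_algebra K "L i" by (rule L[OF that])
    show ?thesis using that assms by (simp add: act_def P_simps PiE_iff)
  qed
qed (use assms in simp)

text \<open>Turns a linear relation in \<open>B\<close> into a single multiplier of
  \<open>x\<close>. The map \<open>f\<close> is linear over \<open>K\<close> only, so the constants
  \<open>c l\<close> come out and the functions \<open>u l\<close> stay inside.\<close>

lemma f_act_finsum:
  assumes "finite F" "c \<in> F \<rightarrow> carrier K" "\<And>l. l \<in> F \<Longrightarrow> u l \<in> I \<rightarrow> carrier K" "x \<in> carrier P"
  shows "f (act (\<lambda>i. \<Oplus>\<^bsub>K\<^esub>l\<in>F. c l \<otimes>\<^bsub>K\<^esub> u l i) x) = (\<Oplus>\<^bsub>B\<^esub>l\<in>F. c l \<odot>\<^bsub>B\<^esub> f (act (u l) x))"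
  using assms
proof (induction F rule: finite_induct)
  case empty
  then show ?case by (simp add: f_act_zero)
next
  case (insert m F)
  have m: "c m \<in> carrier K" "u m \<in> I \<rightarrow> carrier K" "(\<lambda>i. c m \<otimes>\<^bsub>K\<^esub> u m i) \<in> I \<rightarrow> carrier K"
    using insert.prems by auto
  have F: "(\<lambda>i. \<Oplus>\<^bsub>K\<^esub>l\<in>F. c l \<otimes>\<^bsub>K\<^esub> u l i) \<in> I \<rightarrow> carrier K"
    using insert.prems by (auto intro!: B.R.finsum_closed simp: Pi_iff)
  have "f (act (\<lambda>i. \<Oplus>\<^bsub>K\<^esub>l\<in>insert m F. c l \<otimes>\<^bsub>K\<^esub> u l i) x)
      = f (act (\<lambda>i. c m \<otimes>\<^bsub>K\<^esub> u m i \<oplus>\<^bsub>K\<^esub> (\<Oplus>\<^bsub>K\<^esub>l\<in>F. c l \<otimes>\<^bsub>K\<^esub> u l i)) x)"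
    using insert by (intro arg_cong[of _ _ f] act_cong B.R.finsum_insert) (auto simp: Pi_iff)
  also have "\<dots> = c m \<odot>\<^bsub>B\<^esub> f (act (u m) x) \<oplus>\<^bsub>B\<^esub> (\<Oplus>\<^bsub>B\<^esub>l\<in>F. c l \<odot>\<^bsub>B\<^esub> f (act (u l) x))"
    using m F insert by (simp add: act_add act_smult f_add f_smult P_closed)
  also have "\<dots> = (\<Oplus>\<^bsub>B\<^esub>l\<in>insert m F. c l \<odot>\<^bsub>B\<^esub> f (act (u l) x))"
    using insert by (subst B.M.finsum_insert) (auto simp: Pi_iff)
  finally show ?case .
qed

text \<open>By surjectivity every element of \<open>B\<close> is some \<open>f y\<close>, and moving
  \<open>g\<close> from \<open>x\<close> to \<open>y\<close> inside the bracket leaves a bracket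
  with the central element \<open>f x\<close>.\<close>

lemma f_act_central:
  assumes g: "g \<in> I \<rightarrow> carrier K" and x: "x \<in> carrier P" and c: "f x \<in> lie_center B"
  shows "f (act g x) \<in> lie_center B"
  unfolding lie_center_def
proof (intro CollectI conjI ballI)
  show "f (act g x) \<in> carrier B" using g x by simp
  fix b assume "b \<in> carrier B"
  then obtain y where y: "y \<in> carrier P" "b = f y" using f_surj by blast
  have "f (act g x) \<otimes>\<^bsub>B\<^esub> b = f (act g x \<otimes>\<^bsub>P\<^esub> y)" using g x y by (simp add: f_bracket)
  also have "\<dots> = f x \<otimes>\<^bsub>B\<^esub> f (act g y)" using g x y by (simp add: act_bracket f_bracket)
  finally show "f (act g x) \<otimes>\<^bsub>B\<^esub> b = \<zero>\<^bsub>B\<^esub>" using c g y(1) B.lie_center_bracket by simp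
qed

section \<open>The ideal of index sets with central image\<close>

definition restr :: "'i set \<Rightarrow> ('i \<Rightarrow> 'a) \<Rightarrow> 'i \<Rightarrow> 'a"
  where "restr S x = (\<lambda>i\<in>I. if i \<in> S then x i else \<zero>\<^bsub>L i\<^esub>)"

lemma restr_closed [simp]: "x \<in> carrier P \<Longrightarrow> restr S x \<in> carrier P"
  by (auto simp: restr_def P_simps L_closed PiE_iff)

text \<open>A member may reach outside \<open>I\<close>, but only its part in \<open>I\<close>
  matters.\<close>

definition central_sets :: "('i \<Rightarrow> 'a) \<Rightarrow> 'i set set"
  where "central_sets x = {S. f (restr S x) \<in> lie_center B}"

text \<open>\<open>h\<close> inverts \<open>g\<close> on \<open>S\<close> and is zero
  elsewhere.\<close>

lemma restr_eq_act:
  assumes "g \<in> I \<rightarrow> carrier K" "x \<in> carrier P" "\<And>i. \<lbrakk>i \<in> I; i \<in> S\<rbrakk> \<Longrightarrow> g i \<noteq> \<zero>\<^bsub>K\<^esub>"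
  shows "\<exists>h \<in> I \<rightarrow> carrier K. restr S x = act h (act g x)"
proof
  let ?h = "\<lambda>i. if i \<in> S then inv\<^bsub>K\<^esub> (g i) else \<zero>\<^bsub>K\<^esub>"
  show h: "?h \<in> I \<rightarrow> carrier K" using assms by (auto intro!: B.m_inv_closed simp: Pi_iff)
  show "restr S x = act ?h (act g x)"
    unfolding act_act[OF h assms(1,2)]
  proof
    fix i
    show "restr S x i = act (\<lambda>i. ?h i \<otimes>\<^bsub>K\<^esub> g i) x i"
    proof (cases "i \<in> I")
      case True
      then interpret Li: lie_algebra K "L i" by (rule L)
      have gi: "g i \<in> carrier K" using assms(1) True by auto
      have "inv\<^bsub>K\<^esub> (g i) \<otimes>\<^bsub>K\<^esub> g i = \<one>\<^bsub>K\<^esub>" if "i \<in> S"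
        using gi assms(3)[OF True that] B.mult_inv_cancel B.m_inv_closed
        by (simp add: B.R.m_comm)
      then show ?thesis
        using True gi P_component[OF assms(2) True] by (simp add: restr_def act_def)
    qed (simp add: act_def restr_def)
  qed
qed

text \<open>The criterion by which all three cases find members of the ideal: a multiplier with
  central image that does not vanish on \<open>S\<close>.\<close>

lemma central_sets_of_act:
  assumes "g \<in> I \<rightarrow> carrier K" "x \<in> carrier P" "f (act g x) \<in> lie_center B"
    "\<And>i. \<lbrakk>i \<in> I; i \<in> S\<rbrakk> \<Longrightarrow> g i \<noteq> \<zero>\<^bsub>K\<^esub>"
  shows "S \<in> central_sets x"
proof -
  obtain h where "h \<in> I \<rightarrow> carrier K" "restr S x = act h (act g x)"
    using restr_eq_act[OF assms(1,2,4)] by blast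
  then show ?thesis using assms(1-3) f_act_central[of h "act g x"] by (simp add: central_sets_def)
qed

lemma restr_Un:
  assumes "x \<in> carrier P" "S \<inter> T = {}"
  shows "restr (S \<union> T) x = restr S x \<oplus>\<^bsub>P\<^esub> restr T x"
proof
  fix i
  show "restr (S \<union> T) x i = (restr S x \<oplus>\<^bsub>P\<^esub> restr T x) i"
  proof (cases "i \<in> I")
    case True
    then interpret Li: lie_algebra K "L i" by (rule L)
    show ?thesis using True assms P_component[OF assms(1) True] by (auto simp: restr_def P_simps)
  qed (simp add: restr_def P_simps)
qed

text \<open>Subsets are reached by acting with an indicator function. Unions are first made
  disjoint, as \<open>restr_Un\<close> requires.\<close>

lemma set_ideal_central_sets:
  assumes x: "x \<in> carrier P"
  shows "set_ideal (central_sets x)"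
proof
  show "{} \<in> central_sets x"
  proof -
    have "f (restr {} x) = \<zero>\<^bsub>B\<^esub>"
      using x by (intro f_zero[OF restr_closed]) (auto simp: restr_def)
    then show ?thesis by (simp add: central_sets_def B.lie_center_zero)
  qed
  show sub: "T \<in> central_sets x" if "S \<in> central_sets x" "T \<subseteq> S" for S T
  proof -
    let ?h = "\<lambda>i. if i \<in> T then \<one>\<^bsub>K\<^esub> else \<zero>\<^bsub>K\<^esub>"
    have "restr T x = act ?h (restr S x)"
    proof
      fix i
      show "restr T x i = act ?h (restr S x) i"
      proof (cases "i \<in> I")
        case True
        then interpret Li: lie_algebra K "L i" by (rule L)
        show ?thesis using True that(2) P_component[OF x True] by (auto simp: restr_def act_def)
      qed (simp add: act_def restr_def)
    qed
    moreover have "f (act ?h (restr S x)) \<in> lie_center B"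
      using that(1) x by (intro f_act_central) (auto simp: central_sets_def)
    ultimately show ?thesis by (simp add: central_sets_def)
  qed
  show "S \<union> T \<in> central_sets x" if "S \<in> central_sets x" "T \<in> central_sets x" for S T
  proof -
    have "restr (S \<union> T) x = restr S x \<oplus>\<^bsub>P\<^esub> restr (T - S) x"
      using restr_Un[OF x, of S "T - S"] by simp
    moreover have "T - S \<in> central_sets x" using sub[OF that(2)] by blast
    ultimately show ?thesis
      using that(1) x by (simp add: central_sets_def f_add B.lie_center_add)
  qed
qed

section \<open>Cofinite central sets in the three cases\<close>

text \<open>A linear relation between the images of the inverses of \<open>g - l\<close> gives a
  multiplier \<open>h\<close> with \<open>f (act h x)\<close> zero. As a sum of partial fractions in
  \<open>g\<close>, it vanishes on finitely many fibres of \<open>g\<close> outside the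
  poles.\<close>

lemma fibre_central:
  assumes S: "vectorspace.basis K B S" "|S| <o |carrier K|" and K: "infinite (carrier K)"
    and x: "x \<in> carrier P" and g: "g \<in> I \<rightarrow> carrier K"
  shows "\<exists>F. finite F \<and> {i\<in>I. g i \<notin> F} \<in> central_sets x"
proof -
  \<comment> \<open>The value zero where \<open>g i = l\<close> is a placeholder: the fibres over
    the poles in \<open>F\<close> are discarded below.\<close>
  define u where "u l i = (if g i = l then \<zero>\<^bsub>K\<^esub> else inv\<^bsub>K\<^esub> (g i \<ominus>\<^bsub>K\<^esub> l))" for l i
  have u: "u l \<in> I \<rightarrow> carrier K" if "l \<in> carrier K" for l
  proof
    fix i assume "i \<in> I"
    then have "g i \<in> carrier K" using g by auto
    then show "u l i \<in> carrier K" using that B.m_inv_closed[of "g i \<ominus>\<^bsub>K\<^esub> l"] by (auto simp: u_def)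
  qed
  have v: "(\<lambda>l. f (act (u l) x)) \<in> carrier K \<rightarrow> carrier B" using u x by auto
  from B.family_larger_than_basis_dependent[OF S K v]
  obtain F c l0 where F: "finite F" "F \<subseteq> carrier K" "c \<in> F \<rightarrow> carrier K"
    and zero: "(\<Oplus>\<^bsub>B\<^esub>l\<in>F. c l \<odot>\<^bsub>B\<^esub> f (act (u l) x)) = \<zero>\<^bsub>B\<^esub>" and l0: "l0 \<in> F" "c l0 \<noteq> \<zero>\<^bsub>K\<^esub>"
    by (elim exE conjE bexE) (rule that)
  define h where "h i = (\<Oplus>\<^bsub>K\<^esub>l\<in>F. c l \<otimes>\<^bsub>K\<^esub> u l i)" for i
  have h: "h \<in> I \<rightarrow> carrier K"
    unfolding h_def using F u by (auto intro!: B.R.finsum_closed simp: Pi_iff subset_iff)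
  have "f (act h x) = \<zero>\<^bsub>B\<^esub>"
    unfolding h_def using F u x zero by (subst f_act_finsum) auto
  then have central: "f (act h x) \<in> lie_center B" by (simp add: B.lie_center_zero)
  \<comment> \<open>Off the fibres over \<open>F\<close>, \<open>h\<close> is this function of
    \<open>g\<close>. Having a nonzero coefficient at \<open>l0\<close> and constant term zero, it
    has finitely many zeros.\<close>
  define Z where "Z = {t \<in> carrier K - F. B.partial_fractions F c t = \<zero>\<^bsub>K\<^esub>}"
  have pf_closed: "B.partial_fractions F c t \<in> carrier K" if "t \<in> carrier K - F" for t
    using F(2,3) that by (rule B.partial_fractions_closed)
  have "finite Z"
  proof (rule ccontr)
    assume Z: "infinite Z"
    have "(\<forall>l\<in>F. c l = \<zero>\<^bsub>K\<^esub>) \<and> \<zero>\<^bsub>K\<^esub> = \<zero>\<^bsub>K\<^esub>"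
      by (rule B.partial_fractions_zeros[OF F(1-3) _ Z]) (auto simp: Z_def)
    then show False using l0 by auto
  qed
  moreover have "{i\<in>I. g i \<notin> F \<union> Z} \<in> central_sets x"
  proof (rule central_sets_of_act[OF h x central])
    fix i assume i: "i \<in> I" "i \<in> {i\<in>I. g i \<notin> F \<union> Z}"
    then have gi: "g i \<in> carrier K - F" "g i \<notin> Z" using g by auto
    have "h i = B.partial_fractions F c (g i)"
      unfolding h_def B.partial_fractions_def
    proof (rule B.R.finsum_cong', simp)
      fix l assume l: "l \<in> F"
      then have "g i \<noteq> l" using gi(1) by auto
      then show eq: "c l \<otimes>\<^bsub>K\<^esub> u l i = c l \<otimes>\<^bsub>K\<^esub> inv\<^bsub>K\<^esub> (g i \<ominus>\<^bsub>K\<^esub> l)" by (simp add: u_def)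
    next
      have "c l \<otimes>\<^bsub>K\<^esub> inv\<^bsub>K\<^esub> (g i \<ominus>\<^bsub>K\<^esub> l) \<in> carrier K" if l: "l \<in> F" for l
      proof -
        have "g i \<noteq> l" "l \<in> carrier K" "c l \<in> carrier K" using gi(1) F l by auto
        then show ?thesis using gi(1) B.m_inv_closed[of "g i \<ominus>\<^bsub>K\<^esub> l"] by auto
      qed
      then show "(\<lambda>l. c l \<otimes>\<^bsub>K\<^esub> inv\<^bsub>K\<^esub> (g i \<ominus>\<^bsub>K\<^esub> l)) \<in> F \<rightarrow> carrier K" by auto
    qed
    then show "h i \<noteq> \<zero>\<^bsub>K\<^esub>" using gi by (simp add: Z_def)
  qed
  ultimately show ?thesis using F(1) by blast
qed

text \<open>The fibres of an injective \<open>g\<close> have at most one point, so discarding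
  finitely many of them discards finitely many indices.\<close>

lemma cofinite_central_of_card_le:
  assumes S: "vectorspace.basis K B S" "|S| <o |carrier K|" and K: "infinite (carrier K)"
    and I: "|I| \<le>o |carrier K|" and x: "x \<in> carrier P"
  shows "\<exists>F. finite F \<and> I - F \<in> central_sets x"
proof -
  interpret set_ideal I "central_sets x" using x by (rule set_ideal_central_sets)
  obtain g where g: "inj_on g I" "g ` I \<subseteq> carrier K" using I card_of_ordLeq[of I "carrier K"] by blast
  then have "g \<in> I \<rightarrow> carrier K" by auto
  from fibre_central[OF S K x this] obtain F where F: "finite F" "{i\<in>I. g i \<notin> F} \<in> central_sets x" by blast
  have "finite {i\<in>I. g i \<in> F}"
    using finite_vimage_IntI[OF F(1) g(1)] by (simp add: vimage_def Int_def conj_commute)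
  moreover have "I - {i\<in>I. g i \<in> F} = {i\<in>I. g i \<notin> F}" by auto
  ultimately show ?thesis using F(2) by metis
qed

text \<open>If \<open>carrier K\<close> has at least continuum many elements, the preceding lemma
  applies. Otherwise \<open>B\<close> has fewer elements than the eventually different family, so
  two of its functions give the same image of \<open>x\<close>, and their difference is a multiplier
  as required.\<close>

lemma cofinite_central_of_countable:
  assumes S: "vectorspace.basis K B S" "|S| <o ctwo ^c natLeq" and K: "infinite (carrier K)"
    and I: "|I| =o natLeq" and x: "x \<in> carrier P"
  shows "\<exists>F. finite F \<and> I - F \<in> central_sets x"
proof -
  have pow: "|UNIV :: nat set set| =o ctwo ^c natLeq"
  proof -
    have "|UNIV :: nat set set| =o ctwo ^c |UNIV :: nat set|"
      using Pow_cexp_ctwo[of "UNIV :: nat set"] by simp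
    also have "ctwo ^c |UNIV :: nat set| =o ctwo ^c natLeq"
      by (intro cexp_cong2 card_of_nat Card_order_ctwo natLeq_Card_order card_of_Card_order)
    finally show ?thesis .
  qed
  have S': "|S| <o |UNIV :: nat set set|"
    using S(2) pow ordIso_symmetric ordLess_ordIso_trans by blast
  show ?thesis
  proof (cases "|UNIV :: nat set set| \<le>o |carrier K|")
    case True
    have "natLeq \<le>o |carrier K|"
      using K infinite_iff_natLeq_ordLeq by blast
    then have "|I| \<le>o |carrier K|" using I ordIso_ordLeq_trans by blast
    moreover have "|S| <o |carrier K|" using S' True ordLess_ordLeq_trans by blast
    ultimately show ?thesis using S(1) K x by (intro cofinite_central_of_card_le)
  next
    case False
    then have "|carrier K| <o |UNIV :: nat set set|" by (simp add: not_ordLeq_iff_ordLess)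
    then have "|carrier K <+> S| <o |UNIV :: nat set set|"
      using S' by (intro card_of_Plus_ordLess_infinite) (auto simp: Finite_Set.finite_set)
    then have small: "|carrier B| <o |UNIV :: nat set set|"
      using ordLeq_ordLess_trans[OF B.card_carrier_le[OF S(1) K]] by blast
    obtain g where g: "\<And>r :: nat set. g r \<in> I \<rightarrow> carrier K"
      and diff: "\<And>r s :: nat set. r \<noteq> s \<Longrightarrow> finite {i\<in>I. g r i = g s i}"
      using eventually_different_family[OF I K] by metis
    have "\<not> inj (\<lambda>r. f (act (g r) x))"
    proof
      assume "inj (\<lambda>r. f (act (g r) x))"
      moreover have "range (\<lambda>r. f (act (g r) x)) \<subseteq> carrier B" using g x by auto
      ultimately have "|UNIV :: nat set set| \<le>o |carrier B|"
        using card_of_ordLeq[of "UNIV :: nat set set" "carrier B"] by blast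
      then show False using small not_ordLess_ordLeq by blast
    qed
    then obtain r s where rs: "r \<noteq> s" "f (act (g r) x) = f (act (g s) x)" by (auto simp: inj_def)
    \<comment> \<open>This is the negative of \<open>g s\<close>, written as a constant multiple so
      that \<open>act_smult\<close> applies. On \<open>I\<close>, the sum \<open>h\<close> vanishes
      only where \<open>g r\<close> and \<open>g s\<close> agree.\<close>
    define m where "m i = \<ominus>\<^bsub>K\<^esub> \<one>\<^bsub>K\<^esub> \<otimes>\<^bsub>K\<^esub> g s i" for i
    define h where "h i = g r i \<oplus>\<^bsub>K\<^esub> m i" for i
    have m: "m \<in> I \<rightarrow> carrier K"
      using g[of s] unfolding m_def
      by (intro funcsetI B.R.m_closed B.R.add.inv_closed B.R.one_closed) auto
    have h: "h \<in> I \<rightarrow> carrier K"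
      using g[of r] m unfolding h_def by (intro funcsetI B.R.add.m_closed) auto
    have "f (act h x) = f (act (g r) x) \<oplus>\<^bsub>B\<^esub> f (act m x)"
      unfolding h_def using g m x by (simp add: act_add f_add)
    also have "f (act m x) = \<ominus>\<^bsub>B\<^esub> f (act (g s) x)"
      unfolding m_def using g x by (simp add: act_smult f_smult B.smult_l_minus)
    finally have "f (act h x) \<in> lie_center B"
      using rs g x by (simp add: B.M.r_neg B.lie_center_zero)
    moreover have "h i \<noteq> \<zero>\<^bsub>K\<^esub>" if "i \<in> I" "i \<in> I - {i\<in>I. g r i = g s i}" for i
    proof -
      have "g r i \<in> carrier K" "g s i \<in> carrier K" using g that(1) by auto
      moreover from this have "h i = g r i \<ominus>\<^bsub>K\<^esub> g s i"
        by (simp add: h_def m_def a_minus_def B.R.l_minus)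
      ultimately show ?thesis using that(2) by auto
    qed
    ultimately have "I - {i\<in>I. g r i = g s i} \<in> central_sets x"
      using h x by (intro central_sets_of_act[of h])
    then show ?thesis using diff[OF rs(1)] by blast
  qed
qed

lemma cofinite_central_of_below_measurables:
  assumes fd: "vectorspace.fin_dim K B" and below: "below_measurables_above I (carrier K)"
    and K: "infinite (carrier K)" and x: "x \<in> carrier P"
  shows "\<exists>F. finite F \<and> I - F \<in> central_sets x"
proof -
  interpret set_ideal I "central_sets x" using x by (rule set_ideal_central_sets)
  obtain S where S: "finite S" "B.basis S" using B.finite_basis_exists[OF fd] by blast
  have "|S| <o |carrier K|" using S(1) K by (rule finite_ordLess_infinite2)
  from cofinite_mem_of_below_measurables[OF K fibre_central[OF S(2) this K x] below]
  show ?thesis .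
qed

section \<open>One finite index set for all elements, and the decomposition of
  \<open>B\<close>\<close>

text \<open>The finite set in \<open>cofin\<close> depends on \<open>x\<close>. Gluing one witness
  for each bad index into a single element shows that the set \<open>J\<close> of bad indices is
  finite, and this \<open>J\<close> then serves for every element.\<close>

lemma uniform_cofinite_central:
  assumes cofin: "\<And>x. x \<in> carrier P \<Longrightarrow> \<exists>F. finite F \<and> I - F \<in> central_sets x"
  shows "\<exists>J. finite J \<and> J \<subseteq> I \<and> (\<forall>x \<in> carrier P. I - J \<in> central_sets x)"
proof -
  define J where "J = {i\<in>I. \<exists>x\<in>carrier P. {i} \<notin> central_sets x}"
  have "\<forall>i\<in>J. \<exists>x\<in>carrier P. {i} \<notin> central_sets x" by (simp add: J_def)
  then obtain a where a: "\<And>i. i \<in> J \<Longrightarrow> a i \<in> carrier P \<and> {i} \<notin> central_sets (a i)" by metis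
  define x where "x = (\<lambda>i\<in>I. if i \<in> J then a i i else \<zero>\<^bsub>L i\<^esub>)"
  have x: "x \<in> carrier P"
    using a P_component by (auto simp: x_def P_simps(1) L_closed)
  obtain F where F: "finite F" "I - F \<in> central_sets x" using cofin[OF x] by blast
  have "J \<subseteq> F"
  proof
    fix i assume i: "i \<in> J"
    have "restr {i} x = restr {i} (a i)" using i by (auto simp: restr_def x_def)
    then have "{i} \<notin> central_sets x" using a[OF i] by (simp add: central_sets_def)
    moreover have "i \<in> I" using i by (simp add: J_def)
    ultimately show "i \<in> F"
      using set_ideal.subset_mem[OF set_ideal_central_sets[OF x] F(2), of "{i}"] by blast
  qed
  then have "finite J" using F(1) finite_subset by blast
  moreover have "I - J \<in> central_sets y" if y: "y \<in> carrier P" for y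
  proof -
    interpret set_ideal I "central_sets y" using y by (rule set_ideal_central_sets)
    obtain G where G: "finite G" "I - G \<in> central_sets y" using cofin[OF y] by blast
    \<comment> \<open>Outside \<open>J\<close> every singleton is central, so the finitely many
      indices of \<open>G\<close> not in \<open>J\<close> can be restored.\<close>
    have "(\<Union>i\<in>G \<inter> (I - J). {i}) \<in> central_sets y"
      using G(1) y by (intro UN_mem) (auto simp: J_def)
    from Un_mem[OF G(2) this] show ?thesis by (rule subset_mem) auto
  qed
  ultimately show ?thesis by (auto simp: J_def)
qed

lemma f_restr_finsum:
  assumes "finite A" "x \<in> carrier P"
  shows "f (restr A x) = (\<Oplus>\<^bsub>B\<^esub>j\<in>A. f (restr {j} x))"
  using assms(1)
proof (induction A rule: finite_induct)
  case empty
  have "f (restr {} x) = \<zero>\<^bsub>B\<^esub>"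
    using assms(2) by (intro f_zero[OF restr_closed]) (auto simp: restr_def)
  then show ?case by simp
next
  case (insert j A)
  have "f (restr (insert j A) x) = f (restr {j} x) \<oplus>\<^bsub>B\<^esub> f (restr A x)"
    using restr_Un[OF assms(2), of "{j}" A] insert.hyps(2) assms(2) by (simp add: f_add)
  then show ?case using insert assms(2) by (subst B.M.finsum_insert) auto
qed

lemma restr_in_lie_factor: "x \<in> carrier P \<Longrightarrow> restr {j} x \<in> lie_factor I L j"
  by (simp add: lie_factor_def) (simp add: restr_def)

lemma lie_factor_closed: "x \<in> lie_factor I L j \<Longrightarrow> x \<in> carrier P"
  by (simp add: lie_factor_def)

text \<open>At every index one of the two components is zero.\<close>

lemma lie_factors_centralize:
  assumes "i \<noteq> j" "x \<in> lie_factor I L i" "y \<in> lie_factor I L j"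
  shows "f x \<otimes>\<^bsub>B\<^esub> f y = \<zero>\<^bsub>B\<^esub>"
proof -
  have xy: "x \<in> carrier P" "y \<in> carrier P" using assms lie_factor_closed by auto
  have "f (x \<otimes>\<^bsub>P\<^esub> y) = \<zero>\<^bsub>B\<^esub>"
  proof (rule f_zero)
    show "x \<otimes>\<^bsub>P\<^esub> y \<in> carrier P" using xy by (rule P_closed(2))
    fix k assume k: "k \<in> I"
    interpret Lk: lie_algebra K "L k" by (rule L[OF k])
    have "x k \<in> carrier (L k)" "y k \<in> carrier (L k)" using xy k P_component by auto
    moreover have "x k = \<zero>\<^bsub>L k\<^esub> \<or> y k = \<zero>\<^bsub>L k\<^esub>" using assms k by (auto simp: lie_factor_def)
    ultimately show "(x \<otimes>\<^bsub>P\<^esub> y) k = \<zero>\<^bsub>L k\<^esub>" using k by (auto simp: P_simps)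
  qed
  then show ?thesis using xy by (simp add: f_bracket)
qed

lemma restr_decomposition:
  assumes "J \<subseteq> I" "x \<in> carrier P"
  shows "f x = f (restr (I - J) x) \<oplus>\<^bsub>B\<^esub> f (restr J x)"
proof -
  have "x = restr ((I - J) \<union> J) x"
  proof
    fix i
    show "x i = restr ((I - J) \<union> J) x i"
      using assms(2) by (cases "i \<in> I") (auto simp: restr_def P_simps PiE_iff extensional_def)
  qed
  also have "\<dots> = restr (I - J) x \<oplus>\<^bsub>P\<^esub> restr J x"
    using assms(2) by (rule restr_Un) blast
  finally have "f x = f (restr (I - J) x \<oplus>\<^bsub>P\<^esub> restr J x)" by (rule arg_cong)
  then show ?thesis using assms(2) by (simp add: f_add)
qed

lemma center_plus_finite_images_of_central:
  assumes J: "finite J" "J \<subseteq> I" and central: "\<And>x. x \<in> carrier P \<Longrightarrow> I - J \<in> central_sets x"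
  shows "center_plus_finite_images I L B f"
  unfolding center_plus_finite_images_def
proof (intro exI[of _ J] conjI ballI impI J)
  show "carrier B = {z \<oplus>\<^bsub>B\<^esub> (\<Oplus>\<^bsub>B\<^esub>j\<in>J. y j) | z y.
      z \<in> lie_center B \<and> y \<in> (\<Pi> j\<in>J. f ` lie_factor I L j)}" (is "_ = ?S")
  proof
    show "carrier B \<subseteq> ?S"
    proof
      fix b assume "b \<in> carrier B"
      then obtain x where x: "x \<in> carrier P" "b = f x" using f_surj by blast
      have "b = f (restr (I - J) x) \<oplus>\<^bsub>B\<^esub> (\<Oplus>\<^bsub>B\<^esub>j\<in>J. f (restr {j} x))"
        using restr_decomposition[OF J(2) x(1)] f_restr_finsum[OF J(1) x(1)] x(2) by simp
      moreover have "f (restr (I - J) x) \<in> lie_center B"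
        using central[OF x(1)] by (simp add: central_sets_def)
      moreover have "(\<lambda>j. f (restr {j} x)) \<in> (\<Pi> j\<in>J. f ` lie_factor I L j)"
        using restr_in_lie_factor[OF x(1)] by auto
      ultimately show "b \<in> ?S" by blast
    qed
    show "?S \<subseteq> carrier B"
    proof clarify
      fix z y assume z: "z \<in> lie_center B" and y: "y \<in> (\<Pi> j\<in>J. f ` lie_factor I L j)"
      have "y j \<in> carrier B" if "j \<in> J" for j
      proof -
        have "y j \<in> f ` lie_factor I L j" using y that by (rule Pi_mem)
        then show ?thesis using lie_factor_closed by auto
      qed
      then have "(\<Oplus>\<^bsub>B\<^esub>j\<in>J. y j) \<in> carrier B" by (intro B.M.finsum_closed) auto
      then show "z \<oplus>\<^bsub>B\<^esub> (\<Oplus>\<^bsub>B\<^esub>j\<in>J. y j) \<in> carrier B"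
        using z B.lie_center_carrier by (intro B.M.add.m_closed)
    qed
  qed
  fix i j u v
  assume "i \<noteq> j" "u \<in> f ` lie_factor I L i" "v \<in> f ` lie_factor I L j"
  then show "u \<otimes>\<^bsub>B\<^esub> v = \<zero>\<^bsub>B\<^esub>" using lie_factors_centralize by blast
qed

section \<open>Passing solvability and nilpotency to \<open>B\<close>\<close>

text \<open>An upper bound for the terms of both series of \<open>B\<close>: the sets
  \<open>W i\<close> follow the series of the factors in \<open>J\<close>, and the center absorbs
  all other indices.\<close>

definition central_plus_image :: "'i set \<Rightarrow> ('i \<Rightarrow> 'a set) \<Rightarrow> 'b set"
  where "central_plus_image J W = {z \<oplus>\<^bsub>B\<^esub> f y | z y. z \<in> lie_center B \<and> y \<in> carrier P \<and>
    (\<forall>i\<in>J. y i \<in> W i) \<and> (\<forall>i\<in>I - J. y i = \<zero>\<^bsub>L i\<^esub>)}"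

lemma central_plus_imageI:
  assumes "z \<in> lie_center B" "y \<in> carrier P" "\<And>i. i \<in> J \<Longrightarrow> y i \<in> W i"
    "\<And>i. \<lbrakk>i \<in> I; i \<notin> J\<rbrakk> \<Longrightarrow> y i = \<zero>\<^bsub>L i\<^esub>"
  shows "z \<oplus>\<^bsub>B\<^esub> f y \<in> central_plus_image J W"
  using assms unfolding central_plus_image_def by blast

lemma central_plus_imageE:
  assumes "b \<in> central_plus_image J W"
  obtains z y where "b = z \<oplus>\<^bsub>B\<^esub> f y" "z \<in> lie_center B" "y \<in> carrier P"
    "\<And>i. i \<in> J \<Longrightarrow> y i \<in> W i" "\<And>i. \<lbrakk>i \<in> I; i \<notin> J\<rbrakk> \<Longrightarrow> y i = \<zero>\<^bsub>L i\<^esub>"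
  using assms unfolding central_plus_image_def by blast

lemma submodule_central_plus_image:
  assumes J: "J \<subseteq> I" and W: "\<And>i. i \<in> J \<Longrightarrow> submodule K (W i) (L i)"
  shows "submodule K (central_plus_image J W) B"
proof (rule submodule.intro)
  show "module K B" by unfold_locales
  show "central_plus_image J W \<subseteq> carrier B"
    by (auto elim!: central_plus_imageE simp: B.lie_center_carrier)
  show "\<zero>\<^bsub>B\<^esub> \<in> central_plus_image J W"
  proof -
    let ?o = "\<lambda>i\<in>I. \<zero>\<^bsub>L i\<^esub>"
    have o: "?o \<in> carrier P" by (auto simp: P_simps L_closed)
    have "\<zero>\<^bsub>B\<^esub> \<oplus>\<^bsub>B\<^esub> f ?o \<in> central_plus_image J W"
      using J o submodule.zero_closed[OF W] by (intro central_plus_imageI B.lie_center_zero) auto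
    moreover have "f ?o = \<zero>\<^bsub>B\<^esub>" using o by (rule f_zero) simp
    ultimately show ?thesis by simp
  qed
next
  fix v w assume "v \<in> central_plus_image J W" "w \<in> central_plus_image J W"
  then obtain z y z' y' where v: "v = z \<oplus>\<^bsub>B\<^esub> f y" "z \<in> lie_center B" "y \<in> carrier P"
      "\<And>i. i \<in> J \<Longrightarrow> y i \<in> W i" "\<And>i. \<lbrakk>i \<in> I; i \<notin> J\<rbrakk> \<Longrightarrow> y i = \<zero>\<^bsub>L i\<^esub>"
    and w: "w = z' \<oplus>\<^bsub>B\<^esub> f y'" "z' \<in> lie_center B" "y' \<in> carrier P"
      "\<And>i. i \<in> J \<Longrightarrow> y' i \<in> W i" "\<And>i. \<lbrakk>i \<in> I; i \<notin> J\<rbrakk> \<Longrightarrow> y' i = \<zero>\<^bsub>L i\<^esub>"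
    by (elim central_plus_imageE) (rule that)
  have "v \<oplus>\<^bsub>B\<^esub> w = (z \<oplus>\<^bsub>B\<^esub> z') \<oplus>\<^bsub>B\<^esub> f (y \<oplus>\<^bsub>P\<^esub> y')"
    using v(1-3) w(1-3) B.lie_center_carrier[OF v(2)] B.lie_center_carrier[OF w(2)]
    by (simp add: f_add B.M.add.m_ac)
  also have "\<dots> \<in> central_plus_image J W"
  proof (rule central_plus_imageI)
    show "z \<oplus>\<^bsub>B\<^esub> z' \<in> lie_center B" using v(2) w(2) by (rule B.lie_center_add)
    show "y \<oplus>\<^bsub>P\<^esub> y' \<in> carrier P" using v(3) w(3) by (rule P_closed(1))
    show "(y \<oplus>\<^bsub>P\<^esub> y') i \<in> W i" if "i \<in> J" for i
      using submodule.m_closed[OF W[OF that] v(4)[OF that] w(4)[OF that]] that J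
      by (auto simp: P_simps)
    show "(y \<oplus>\<^bsub>P\<^esub> y') i = \<zero>\<^bsub>L i\<^esub>" if "i \<in> I" "i \<notin> J" for i
    proof -
      interpret Li: lie_algebra K "L i" by (rule L[OF that(1)])
      show ?thesis using v(5)[OF that] w(5)[OF that] that(1) by (simp add: P_simps)
    qed
  qed
  finally show "v \<oplus>\<^bsub>B\<^esub> w \<in> central_plus_image J W" .
next
  fix c v assume c: "c \<in> carrier K" and "v \<in> central_plus_image J W"
  then obtain z y where v: "v = z \<oplus>\<^bsub>B\<^esub> f y" "z \<in> lie_center B" "y \<in> carrier P"
      "\<And>i. i \<in> J \<Longrightarrow> y i \<in> W i" "\<And>i. \<lbrakk>i \<in> I; i \<notin> J\<rbrakk> \<Longrightarrow> y i = \<zero>\<^bsub>L i\<^esub>"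
    by (elim central_plus_imageE) (rule that)
  have "c \<odot>\<^bsub>B\<^esub> v = c \<odot>\<^bsub>B\<^esub> z \<oplus>\<^bsub>B\<^esub> f (c \<odot>\<^bsub>P\<^esub> y)"
    using v(1-3) c B.lie_center_carrier[OF v(2)] by (simp add: f_smult B.smult_r_distr)
  also have "\<dots> \<in> central_plus_image J W"
  proof (rule central_plus_imageI)
    show "c \<odot>\<^bsub>B\<^esub> z \<in> lie_center B" using c v(2) by (rule B.lie_center_smult)
    show "c \<odot>\<^bsub>P\<^esub> y \<in> carrier P" using c v(3) by (rule P_closed(3))
    show "(c \<odot>\<^bsub>P\<^esub> y) i \<in> W i" if "i \<in> J" for i
      using submodule.smult_closed[OF W[OF that] c v(4)[OF that]] that J by (auto simp: P_simps)
    show "(c \<odot>\<^bsub>P\<^esub> y) i = \<zero>\<^bsub>L i\<^esub>" if "i \<in> I" "i \<notin> J" for i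
    proof -
      interpret Li: lie_algebra K "L i" by (rule L[OF that(1)])
      show ?thesis using v(5)[OF that] that(1) c by (simp add: P_simps)
    qed
  qed
  finally show "c \<odot>\<^bsub>B\<^esub> v \<in> central_plus_image J W" .
qed

text \<open>The induction step for both series. Central summands disappear in a bracket, and what
  remains is computed in each factor separately.\<close>

lemma bracket_span_central_plus_image:
  assumes J: "J \<subseteq> I"
    and W: "\<And>i. i \<in> J \<Longrightarrow> W i \<subseteq> carrier (L i)" and W': "\<And>i. i \<in> J \<Longrightarrow> W' i \<subseteq> carrier (L i)"
    and S: "S \<subseteq> central_plus_image J W" and S': "S' \<subseteq> central_plus_image J W'"
  shows "bracket_span K B S S' \<subseteq> central_plus_image J (\<lambda>i. bracket_span K (L i) (W i) (W' i))"
proof (rule B.bracket_span_least)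
  have L': "lie_algebra_over K (L i)" if "i \<in> J" for i
    using L J that by (auto intro: lie_algebra_over.intro)
  show "submodule K (central_plus_image J (\<lambda>i. bracket_span K (L i) (W i) (W' i))) B"
    using J W W' by (intro submodule_central_plus_image lie_algebra_over.bracket_span_submodule L')
  fix v w assume "v \<in> S" "w \<in> S'"
  then have "v \<in> central_plus_image J W" "w \<in> central_plus_image J W'" using S S' by auto
  then obtain z y z' y' where v: "v = z \<oplus>\<^bsub>B\<^esub> f y" "z \<in> lie_center B" "y \<in> carrier P"
      "\<And>i. i \<in> J \<Longrightarrow> y i \<in> W i" "\<And>i. \<lbrakk>i \<in> I; i \<notin> J\<rbrakk> \<Longrightarrow> y i = \<zero>\<^bsub>L i\<^esub>"
    and w: "w = z' \<oplus>\<^bsub>B\<^esub> f y'" "z' \<in> lie_center B" "y' \<in> carrier P"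
      "\<And>i. i \<in> J \<Longrightarrow> y' i \<in> W' i" "\<And>i. \<lbrakk>i \<in> I; i \<notin> J\<rbrakk> \<Longrightarrow> y' i = \<zero>\<^bsub>L i\<^esub>"
    by (elim central_plus_imageE) (rule that)
  have fy: "f y \<in> carrier B" "f y' \<in> carrier B" using v(3) w(3) by auto
  note z = B.lie_center_carrier[OF v(2)] B.lie_center_carrier[OF w(2)]
  have "v \<otimes>\<^bsub>B\<^esub> w = f y \<otimes>\<^bsub>B\<^esub> f y'"
    using fy z v(1,2) w(1,2) B.bracket_closed
    by (simp add: B.bracket_add_left B.bracket_add_right B.lie_center_bracket B.bracket_lie_center)
  also have "\<dots> = \<zero>\<^bsub>B\<^esub> \<oplus>\<^bsub>B\<^esub> f (y \<otimes>\<^bsub>P\<^esub> y')"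
    using fy v(3) w(3) B.bracket_closed by (simp add: f_bracket)
  also have "\<dots> \<in> central_plus_image J (\<lambda>i. bracket_span K (L i) (W i) (W' i))"
  proof (rule central_plus_imageI)
    show "\<zero>\<^bsub>B\<^esub> \<in> lie_center B" by (rule B.lie_center_zero)
    show "y \<otimes>\<^bsub>P\<^esub> y' \<in> carrier P" using v(3) w(3) by (rule P_closed(2))
    show "(y \<otimes>\<^bsub>P\<^esub> y') i \<in> bracket_span K (L i) (W i) (W' i)" if "i \<in> J" for i
      using lie_algebra_over.bracket_in_bracket_span[OF L'[OF that] W[OF that] W'[OF that]
          v(4)[OF that] w(4)[OF that]] that J
      by (auto simp: P_simps)
    show "(y \<otimes>\<^bsub>P\<^esub> y') i = \<zero>\<^bsub>L i\<^esub>" if "i \<in> I" "i \<notin> J" for i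
    proof -
      interpret Li: lie_algebra K "L i" by (rule L[OF that(1)])
      show ?thesis using v(5)[OF that] w(5)[OF that] that(1) by (simp add: P_simps)
    qed
  qed
  finally show "v \<otimes>\<^bsub>B\<^esub> w \<in> central_plus_image J (\<lambda>i. bracket_span K (L i) (W i) (W' i))" .
qed

lemma carrier_central_plus_image:
  assumes J: "J \<subseteq> I" and central: "\<And>x. x \<in> carrier P \<Longrightarrow> I - J \<in> central_sets x"
  shows "carrier B \<subseteq> central_plus_image J (\<lambda>i. carrier (L i))"
proof
  fix b assume "b \<in> carrier B"
  then obtain x where x: "x \<in> carrier P" "b = f x" using f_surj by blast
  have "f (restr (I - J) x) \<oplus>\<^bsub>B\<^esub> f (restr J x) \<in> central_plus_image J (\<lambda>i. carrier (L i))"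
  proof (rule central_plus_imageI)
    show "f (restr (I - J) x) \<in> lie_center B" using central[OF x(1)] by (simp add: central_sets_def)
    show "restr J x \<in> carrier P" using x(1) by simp
    show "restr J x i \<in> carrier (L i)" if "i \<in> J" for i
      using P_component[OF x(1)] that J by (auto simp: restr_def)
  qed (auto simp: restr_def)
  then show "b \<in> central_plus_image J (\<lambda>i. carrier (L i))"
    using restr_decomposition[OF J x(1)] x(2) by simp
qed

lemma central_plus_image_zero:
  assumes "J \<subseteq> I"  "\<And>i. i \<in> J \<Longrightarrow> W i = {\<zero>\<^bsub>L i\<^esub>}"
  shows "central_plus_image J W \<subseteq> lie_center B"
proof
  fix b assume "b \<in> central_plus_image J W"
  then obtain z y where b: "b = z \<oplus>\<^bsub>B\<^esub> f y" "z \<in> lie_center B" "y \<in> carrier P"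
      "\<And>i. i \<in> J \<Longrightarrow> y i \<in> W i" "\<And>i. \<lbrakk>i \<in> I; i \<notin> J\<rbrakk> \<Longrightarrow> y i = \<zero>\<^bsub>L i\<^esub>"
    by (elim central_plus_imageE) (rule that)
  have "f y = \<zero>\<^bsub>B\<^esub>" using b(3-5) assms by (intro f_zero) auto
  then show "b \<in> lie_center B" using b(1,2) B.lie_center_carrier by simp
qed

text \<open>Once the derived series of all factors in \<open>J\<close> have reached zero, that of
  \<open>B\<close> is contained in the center, and one further step makes it zero.\<close>

lemma lie_solvable_of_central:
  assumes J: "finite J" "J \<subseteq> I" and central: "\<And>x. x \<in> carrier P \<Longrightarrow> I - J \<in> central_sets x"
    and solv: "\<And>i. i \<in> I \<Longrightarrow> lie_solvable K (L i)"
  shows "lie_solvable K B"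
proof -
  have L': "lie_algebra_over K (L i)" if "i \<in> J" for i
    using L J(2) that by (auto intro: lie_algebra_over.intro)
  have D: "derived_series K B n \<subseteq> central_plus_image J (\<lambda>i. derived_series K (L i) n)" for n
  proof (induction n)
    case 0
    show ?case using carrier_central_plus_image[OF J(2) central] by simp
  next
    case (Suc n)
    then show ?case
      using bracket_span_central_plus_image[OF J(2) _ _ Suc Suc]
        lie_algebra_over.derived_series_carrier[OF L'] by simp
  qed
  have "\<forall>i\<in>J. \<exists>n. derived_series K (L i) n = {\<zero>\<^bsub>L i\<^esub>}"
    using solv J(2) by (auto simp: lie_solvable_def)
  then obtain n where n: "\<And>i. i \<in> J \<Longrightarrow> derived_series K (L i) (n i) = {\<zero>\<^bsub>L i\<^esub>}" by metis
  \<comment> \<open>Inserting 0 keeps the maximum meaningful when \<open>J\<close> is empty.\<close>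
  define N where "N = Max (insert 0 (n ` J))"
  have "derived_series K (L i) N = {\<zero>\<^bsub>L i\<^esub>}" if i: "i \<in> J" for i
  proof (rule lie_algebra_over.derived_series_stays_zero[OF L'[OF i] n[OF i]])
    show "n i \<le> N" using i J(1) by (simp add: N_def)
  qed
  then have "central_plus_image J (\<lambda>i. derived_series K (L i) N) \<subseteq> lie_center B"
    by (rule central_plus_image_zero[OF J(2)])
  with D have Z: "derived_series K B N \<subseteq> lie_center B" by (rule subset_trans)
  have "derived_series K B (Suc N) = {\<zero>\<^bsub>B\<^esub>}"
    unfolding derived_series.simps
  proof (rule B.bracket_span_eq_zero[OF B.derived_series_carrier B.derived_series_carrier])
    fix x y assume "x \<in> derived_series K B N" "y \<in> derived_series K B N"
    then show "x \<otimes>\<^bsub>B\<^esub> y = \<zero>\<^bsub>B\<^esub>"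
      using Z B.derived_series_carrier[of N] by (intro B.lie_center_bracket) auto
  qed
  then show ?thesis unfolding lie_solvable_def by blast
qed

text \<open>As in the solvable case, except that one argument of each bracket ranges over all of
  \<open>B\<close>, for which \<open>carr\<close> is the bound.\<close>

lemma lie_nilpotent_of_central:
  assumes J: "finite J" "J \<subseteq> I" and central: "\<And>x. x \<in> carrier P \<Longrightarrow> I - J \<in> central_sets x"
    and nilp: "\<And>i. i \<in> I \<Longrightarrow> lie_nilpotent K (L i)"
  shows "lie_nilpotent K B"
proof -
  have L': "lie_algebra_over K (L i)" if "i \<in> J" for i
    using L J(2) that by (auto intro: lie_algebra_over.intro)
  note carr = carrier_central_plus_image[OF J(2) central]
  have D: "lower_central_series K B n \<subseteq> central_plus_image J (\<lambda>i. lower_central_series K (L i) n)" for n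
  proof (induction n)
    case 0
    show ?case using carr by simp
  next
    case (Suc n)
    then show ?case
      using bracket_span_central_plus_image[OF J(2) _ _ carr Suc]
        lie_algebra_over.lower_central_series_carrier[OF L'] by simp
  qed
  have "\<forall>i\<in>J. \<exists>n. lower_central_series K (L i) n = {\<zero>\<^bsub>L i\<^esub>}"
    using nilp J(2) by (auto simp: lie_nilpotent_def)
  then obtain n where n: "\<And>i. i \<in> J \<Longrightarrow> lower_central_series K (L i) (n i) = {\<zero>\<^bsub>L i\<^esub>}" by metis
  define N where "N = Max (insert 0 (n ` J))"
  have "lower_central_series K (L i) N = {\<zero>\<^bsub>L i\<^esub>}" if i: "i \<in> J" for i
  proof (rule lie_algebra_over.lower_central_series_stays_zero[OF L'[OF i] n[OF i]])
    show "n i \<le> N" using i J(1) by (simp add: N_def)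
  qed
  then have "central_plus_image J (\<lambda>i. lower_central_series K (L i) N) \<subseteq> lie_center B"
    by (rule central_plus_image_zero[OF J(2)])
  with D have Z: "lower_central_series K B N \<subseteq> lie_center B" by (rule subset_trans)
  have "lower_central_series K B (Suc N) = {\<zero>\<^bsub>B\<^esub>}"
    unfolding lower_central_series.simps
  proof (rule B.bracket_span_eq_zero[OF subset_refl B.lower_central_series_carrier])
    fix x y assume "x \<in> carrier B" "y \<in> lower_central_series K B N"
    then show "x \<otimes>\<^bsub>B\<^esub> y = \<zero>\<^bsub>B\<^esub>"
      using Z by (intro B.bracket_lie_center) auto
  qed
  then show ?thesis unfolding lie_nilpotent_def by blast
qed

end

theorem theorem10:
  fixes K :: "('k, 'm) ring_scheme"
    and I :: "'i set"
    and L :: "'i \<Rightarrow> ('k, 'a) module"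
    and B :: "('k, 'b) module"
    and f :: "('i \<Rightarrow> 'a) \<Rightarrow> 'b"
  assumes "field K" and "infinite (carrier K)"
    and "\<And>i. i \<in> I \<Longrightarrow> lie_algebra K (L i)"
    and "lie_algebra K B"
    and "f \<in> lie_hom K (lie_prod I L) B"
    and "f ` carrier (lie_prod I L) = carrier B"
    and "((\<exists>S. vectorspace.basis K B S \<and> |S| <o |carrier K| ) \<and> |I| \<le>o |carrier K| ) \<or>
         ((\<exists>S. vectorspace.basis K B S \<and> |S| <o ctwo ^c natLeq) \<and> |I| =o natLeq) \<or>
         (vectorspace.fin_dim K B \<and> below_measurables_above I (carrier K))"
  shows "((\<forall>i\<in>I. lie_solvable K (L i)) \<longrightarrow>
            lie_solvable K B \<and> center_plus_finite_images I L B f) \<and>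
         ((\<forall>i\<in>I. lie_nilpotent K (L i)) \<longrightarrow>
            lie_nilpotent K B \<and> center_plus_finite_images I L B f)"
proof -
  interpret lie_product_map K I L B f
    using assms(3-6)
    by (intro lie_product_map.intro lie_algebra_over.intro lie_product_map_axioms.intro)
  \<comment> \<open>The three alternative hypotheses enter only through this fact.\<close>
  have "\<exists>F. finite F \<and> I - F \<in> central_sets x" if "x \<in> carrier P" for x
    using assms(7) cofinite_central_of_card_le[OF _ _ assms(2) _ that]
      cofinite_central_of_countable[OF _ _ assms(2) _ that]
      cofinite_central_of_below_measurables[OF _ _ assms(2) that] by blast
  then obtain J where J: "finite J" "J \<subseteq> I" and central: "\<And>x. x \<in> carrier P \<Longrightarrow> I - J \<in> central_sets x"
    using uniform_cofinite_central by blast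
  show ?thesis
    using lie_solvable_of_central[OF J central] lie_nilpotent_of_central[OF J central]
      center_plus_finite_images_of_central[OF J central] by blast
qed

end
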